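(* Let $\mathbb{k}$ be a field. There exists a monomial ordering of the shuffle tree monomials in two binary generators $\mu$ and $\lambda$ (encoding the operations $\mu\colon a_1,a_2\mapsto a_1\cdot a_2$ and $\lambda\colon a_1,a_2\mapsto\{a_1,a_2\}$ of the Poisson operad) with both of the following properties. (1) In each of the three Leibniz relations $$\{a_1,a_2\cdot a_3\}=\{a_1,a_2\}\cdot a_3+\{a_1,a_3\}\cdot a_2,$$ $$-\{a_1\cdot a_3,a_2\}=-\{a_1,a_2\}\cdot a_3+a_1\cdot\{a_2,a_3\},$$ $$-\{a_1\cdot a_2,a_3\}=-a_1\cdot\{a_2,a_3\}-\{a_1,a_3\}\cdot a_2,$$ the leading monomial is the one on the left-hand side, i.e. the leading monomials are respectively $\{a_1,a_2\cdot a_3\}$, $\{a_1\cdot a_3,a_2\}$ and $\{a_1\cdot a_2,a_3\}$. (2) For that same ordering, the defining relations of the Poisson operad, viewed as relations of the associated shuffle operad, form a (quadratic) Gröbner basis of the ideal of relations of the Poisson operad in the free $\mathbb{k}$-linear shuffle operad generated by $\mu$ and $\lambda$.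
   Context: **Poisson operad.** The $\mathbb{k}$-linear symmetric operad $\mathsf{Pois}$ is generated by a symmetric binary operation $a_1,a_2\mapsto a_1\cdot a_2$ and a skew-symmetric binary operation $a_1,a_2\mapsto\{a_1,a_2\}$ subject to the identities $$(a_1\cdot a_2)\cdot a_3=a_1\cdot(a_2\cdot a_3),$$ $$\{a_1,a_2\cdot a_3\}=\{a_1,a_2\}\cdot a_3+\{a_1,a_3\}\cdot a_2,$$ $$\{a_1,\{a_2,a_3\}\}=\{\{a_1,a_2\},a_3\}-\{\{a_1,a_3\},a_2\}.$$ **Shuffle version.** Regarded as a shuffle operad, $\mathsf{Pois}$ is the quotient of the free $\mathbb{k}$-linear shuffle operad $\mathcal{T}^{sh}(\mu,\lambda)$ on two arity-two generators $\mu,\lambda$ by the ideal generated by the defining relations. These are the elements of arity three obtained by applying all permutations in $S_3$ to the arguments of the identities above and rewriting the result, using the (skew-)symmetry of the operations, in terms of shuffle tree monomials. Explicitly (up to scalars) they are: the pairwise equalities of the three monomials $(a_1\cdot a_2)\cdot a_3$, $(a_1\cdot a_3)\cdot a_2$, $a_1\cdot(a_2\cdot a_3)$; the three Leibniz relations displayed in the claim; and the Jacobi relation $\{a_1,\{a_2,a_3\}\}=\{\{a_1,a_2\},a_3\}-\{\{a_1,a_3\},a_2\}$. **Shuffle tree monomials.** $\mathcal{T}^{sh}(\mu,\lambda)(n)$ has a $\mathbb{k}$-basis of shuffle tree monomials: planar rooted binary trees with $n$ leaves labelled bijectively by $1,\dots,n$, whose internal vertices are labelled by $\mu$ or $\lambda$,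 such that at each internal vertex the minimal leaf label of the left subtree is smaller than the minimal leaf label of the right subtree. Structure maps of a shuffle operad are compositions indexed by two-level shuffle trees, equivalently by surjections $f\colon\{1,\dots,m\}\to\{1,\dots,n\}$ with $\min f^{-1}(1)<\cdots<\min f^{-1}(n)$; on tree monomials they are given by grafting, with leaves relabelled according to $f$. **Monomial ordering.** A total order on the shuffle tree monomials of each arity $n\geq 1$ such that every shuffle composition is strictly increasing in each of its arguments: replacing one argument by a greater tree monomial of the same arity makes the result greater. (Each arity contains finitely many tree monomials, so these are well-orders.) The leading monomial of a nonzero element is the greatest tree monomial appearing in it with nonzero coefficient. **Gröbner basis.** A subset $G$ of an ideal $I$ of $\mathcal{T}^{sh}(\mu,\lambda)$ is a Gröbner basis of $I$ if the leading monomial of every nonzero element of $I$ is divisible, as a shuffle tree monomial, by the leading monomial of some element of $G$ (that is, it belongs to the ideal generated by the leading monomials of elements of $G$). It is quadratic if all its elements are linear combinations of tree monomials with exactly two internal vertices. *)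

theory Defs
  imports "HOL-Library.Poly_Mapping" "HOL-Library.FuncSet" "HOL-Combinatorics.Permutations"
begin

datatype gen = Mu | Lam

datatype (leaves: 'a) optree =
  Leaf 'a
| Node gen "'a optree" "'a optree"
for map: relabel

primrec internal_vertices :: "'a optree \<Rightarrow> nat" where
  "internal_vertices (Leaf a) = 0"
| "internal_vertices (Node g l r) = Suc (internal_vertices l + internal_vertices r)"

text \<open>The disjointness condition makes the labelling of the leaves injective.\<close>

primrec shuffle_tree :: "nat optree \<Rightarrow> bool" where
  "shuffle_tree (Leaf a) \<longleftrightarrow> True"
| "shuffle_tree (Node g l r) \<longleftrightarrow>
     leaves l \<inter> leaves r = {} \<and> Min (leaves l) < Min (leaves r) \<and> shuffle_tree l \<and> shuffle_tree r"

definition tree_monomials :: "nat \<Rightarrow> nat optree set" where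
  "tree_monomials n = {t. shuffle_tree t \<and> leaves t = {1..n}}"

definition fiber :: "nat \<Rightarrow> (nat \<Rightarrow> nat) \<Rightarrow> nat \<Rightarrow> nat set" where
  "fiber m f i = {j \<in> {1..m}. f j = i}"

definition shuffle_surj :: "nat \<Rightarrow> nat \<Rightarrow> (nat \<Rightarrow> nat) \<Rightarrow> bool" where
  "shuffle_surj m n f \<longleftrightarrow> 1 \<le> n \<and> f ` {1..m} = {1..n} \<and>
     (\<forall>i\<in>{1..n}. \<forall>j\<in>{1..n}. i < j \<longrightarrow> Min (fiber m f i) < Min (fiber m f j))"

primrec graft :: "'a optree \<Rightarrow> ('a \<Rightarrow> 'b optree) \<Rightarrow> 'b optree" where
  "graft (Leaf a) ts = ts a"
| "graft (Node g l r) ts = Node g (graft l ts) (graft r ts)"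

text \<open>The leaves \<open>1, \<dots>, k\<close> of \<open>ts i\<close>, where \<open>k = card (fiber m f i)\<close>, are relabelled along
  the increasing bijection from \<open>{1..k}\<close> onto \<open>fiber m f i\<close>.\<close>

definition tree_comp ::
  "nat \<Rightarrow> (nat \<Rightarrow> nat) \<Rightarrow> nat optree \<Rightarrow> (nat \<Rightarrow> nat optree) \<Rightarrow> nat optree" where
  "tree_comp m f t ts =
     graft t (\<lambda>i. relabel (\<lambda>j. sorted_list_of_set (fiber m f i) ! (j - 1)) (ts i))"

text \<open>Formal linear combinations of labelled trees; \<open>operad_component n\<close> is the arity \<open>n\<close>
  component of the free shuffle operad on \<open>Mu\<close> and \<open>Lam\<close>.\<close>

type_synonym 'k lincomb = "nat optree \<Rightarrow>\<^sub>0 'k"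

abbreviation monomial :: "nat optree \<Rightarrow> 'k::field lincomb" where
  "monomial t \<equiv> Poly_Mapping.single t 1"

definition operad_component :: "nat \<Rightarrow> 'k::field lincomb set" where
  "operad_component n = {x. Poly_Mapping.keys x \<subseteq> tree_monomials n}"

text \<open>The multilinear extension of \<open>tree_comp\<close>.\<close>

definition shuffle_comp ::
  "nat \<Rightarrow> nat \<Rightarrow> (nat \<Rightarrow> nat) \<Rightarrow> 'k::field lincomb \<Rightarrow> (nat \<Rightarrow> 'k lincomb) \<Rightarrow> 'k lincomb" where
  "shuffle_comp m n f x ys =
     (\<Sum>t \<in> Poly_Mapping.keys x. \<Sum>ts \<in> (\<Pi>\<^sub>E i\<in>{1..n}. Poly_Mapping.keys (ys i)).
        Poly_Mapping.single (tree_comp m f t ts)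
          (Poly_Mapping.lookup x t * (\<Prod>i\<in>{1..n}. Poly_Mapping.lookup (ys i) (ts i))))"

text \<open>\<open>generated_ideal G n x\<close>: the element \<open>x\<close> of arity \<open>n\<close> lies in the ideal generated by the
  family \<open>G\<close>, where \<open>G n\<close> is the set of generators of arity \<open>n\<close>.\<close>

inductive generated_ideal :: "(nat \<Rightarrow> 'k::field lincomb set) \<Rightarrow> nat \<Rightarrow> 'k lincomb \<Rightarrow> bool"
  for G :: "nat \<Rightarrow> 'k::field lincomb set" where
  generator: "x \<in> G n \<Longrightarrow> generated_ideal G n x"
| zero: "generated_ideal G n 0"
| add: "generated_ideal G n x \<Longrightarrow> generated_ideal G n y \<Longrightarrow> generated_ideal G n (x + y)"
| scale: "generated_ideal G n x \<Longrightarrow> generated_ideal G n (Poly_Mapping.map (\<lambda>a. c * a) x)"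
| comp_root:
    "\<lbrakk>shuffle_surj m n f; generated_ideal G n x;
      \<forall>i\<in>{1..n}. ys i \<in> operad_component (card (fiber m f i))\<rbrakk>
     \<Longrightarrow> generated_ideal G m (shuffle_comp m n f x ys)"
| comp_arg:
    "\<lbrakk>shuffle_surj m n f; x \<in> operad_component n;
      \<forall>i\<in>{1..n}. ys i \<in> operad_component (card (fiber m f i));
      i \<in> {1..n}; generated_ideal G (card (fiber m f i)) (ys i)\<rbrakk>
     \<Longrightarrow> generated_ideal G m (shuffle_comp m n f x ys)"

definition operad_ideal :: "(nat \<Rightarrow> 'k::field lincomb set) \<Rightarrow> nat \<Rightarrow> 'k lincomb set" where
  "operad_ideal G n = {x. generated_ideal G n x}"

text \<open>\<open>tree_divides s t\<close>: the tree monomial \<open>t\<close> is obtained from \<open>s\<close> by iterated shuffle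
  compositions with tree monomials.\<close>

inductive tree_divides :: "nat optree \<Rightarrow> nat optree \<Rightarrow> bool" for s where
  refl: "tree_divides s s"
| comp_root:
    "\<lbrakk>shuffle_surj m n f; t \<in> tree_monomials n; tree_divides s t;
      \<forall>i\<in>{1..n}. ts i \<in> tree_monomials (card (fiber m f i))\<rbrakk>
     \<Longrightarrow> tree_divides s (tree_comp m f t ts)"
| comp_arg:
    "\<lbrakk>shuffle_surj m n f; t \<in> tree_monomials n;
      \<forall>i\<in>{1..n}. ts i \<in> tree_monomials (card (fiber m f i));
      i \<in> {1..n}; tree_divides s (ts i)\<rbrakk>
     \<Longrightarrow> tree_divides s (tree_comp m f t ts)"

text \<open>\<open>(s, t) \<in> ord n\<close> means that \<open>s\<close> is less than or equal to \<open>t\<close> in arity \<open>n\<close>.\<close>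

definition monomial_ordering :: "(nat \<Rightarrow> nat optree rel) \<Rightarrow> bool" where
  "monomial_ordering ord \<longleftrightarrow>
     (\<forall>n\<ge>1. linear_order_on (tree_monomials n) (ord n)) \<and>
     (\<forall>m n f t t' ts.
        shuffle_surj m n f \<and> (\<forall>i\<in>{1..n}. ts i \<in> tree_monomials (card (fiber m f i))) \<and>
        (t, t') \<in> ord n - Id \<longrightarrow>
        (tree_comp m f t ts, tree_comp m f t' ts) \<in> ord m - Id) \<and>
     (\<forall>m n f t ts i s.
        shuffle_surj m n f \<and> t \<in> tree_monomials n \<and>
        (\<forall>i\<in>{1..n}. ts i \<in> tree_monomials (card (fiber m f i))) \<and>
        i \<in> {1..n} \<and> (ts i, s) \<in> ord (card (fiber m f i)) - Id \<longrightarrow>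
        (tree_comp m f t ts, tree_comp m f t (ts(i := s))) \<in> ord m - Id)"

definition is_leading_monomial ::
  "(nat \<Rightarrow> nat optree rel) \<Rightarrow> nat \<Rightarrow> 'k::field lincomb \<Rightarrow> nat optree \<Rightarrow> bool" where
  "is_leading_monomial ord n x t \<longleftrightarrow>
     t \<in> Poly_Mapping.keys x \<and> (\<forall>s\<in>Poly_Mapping.keys x. (s, t) \<in> ord n)"

definition groebner_basis ::
  "(nat \<Rightarrow> nat optree rel) \<Rightarrow> (nat \<Rightarrow> 'k::field lincomb set) \<Rightarrow> (nat \<Rightarrow> 'k lincomb set) \<Rightarrow> bool" where
  "groebner_basis ord G I \<longleftrightarrow>
     (\<forall>n. G n \<subseteq> I n) \<and>
     (\<forall>n\<ge>1. \<forall>x\<in>I n. x \<noteq> 0 \<longrightarrow>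
        (\<exists>t k g s. is_leading_monomial ord n x t \<and>
           1 \<le> k \<and> g \<in> G k \<and> is_leading_monomial ord k g s \<and> tree_divides s t))"

definition quadratic :: "(nat \<Rightarrow> 'k::field lincomb set) \<Rightarrow> bool" where
  "quadratic G \<longleftrightarrow> (\<forall>n. \<forall>g\<in>G n. \<forall>t\<in>Poly_Mapping.keys g. internal_vertices t = 2)"

abbreviation mu :: "nat optree \<Rightarrow> nat optree \<Rightarrow> nat optree" where "mu \<equiv> Node Mu"
abbreviation lam :: "nat optree \<Rightarrow> nat optree \<Rightarrow> nat optree" where "lam \<equiv> Node Lam"
abbreviation a1 :: "nat optree" where "a1 \<equiv> Leaf 1"
abbreviation a2 :: "nat optree" where "a2 \<equiv> Leaf 2"
abbreviation a3 :: "nat optree" where "a3 \<equiv> Leaf 3"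

text \<open>The identities of the symmetric operad, as left-hand side minus right-hand side; here
  the trees need not satisfy the shuffle condition.\<close>

definition poisson_identities :: "'k::field lincomb set" where
  "poisson_identities =
    {monomial (mu (mu a1 a2) a3) - monomial (mu a1 (mu a2 a3)),
     monomial (lam a1 (mu a2 a3)) - (monomial (mu (lam a1 a2) a3) + monomial (mu (lam a1 a3) a2)),
     monomial (lam a1 (lam a2 a3)) - (monomial (lam (lam a1 a2) a3) - monomial (lam (lam a1 a3) a2))}"

text \<open>Rewriting an arbitrary injectively labelled tree as a shuffle tree monomial up to sign: the
  two subtrees at a vertex are exchanged when necessary, at the cost of a sign for \<open>Lam\<close>.\<close>

primrec shuffle_form :: "nat optree \<Rightarrow> nat optree" where
  "shuffle_form (Leaf a) = Leaf a"
| "shuffle_form (Node g l r) =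
     (if Min (leaves l) < Min (leaves r) then Node g (shuffle_form l) (shuffle_form r)
      else Node g (shuffle_form r) (shuffle_form l))"

primrec shuffle_sign :: "nat optree \<Rightarrow> 'k::field" where
  "shuffle_sign (Leaf a) = 1"
| "shuffle_sign (Node g l r) =
     (if Min (leaves l) < Min (leaves r) \<or> g = Mu then 1 else -1) * shuffle_sign l * shuffle_sign r"

definition permute_rewrite :: "(nat \<Rightarrow> nat) \<Rightarrow> 'k::field lincomb \<Rightarrow> 'k lincomb" where
  "permute_rewrite \<sigma> x =
     (\<Sum>t \<in> Poly_Mapping.keys x.
        Poly_Mapping.single (shuffle_form (relabel \<sigma> t))
          (shuffle_sign (relabel \<sigma> t) * Poly_Mapping.lookup x t))"

definition poisson_relations :: "nat \<Rightarrow> 'k::field lincomb set" where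
  "poisson_relations n =
     (if n = 3 then {permute_rewrite \<sigma> x |\<sigma> x. \<sigma> permutes {1..3} \<and> x \<in> poisson_identities} else {})"

end

theory Submission
  imports Defs "HOL-Library.Product_Lexorder"
begin

text \<open>
  A tree is compared through its root paths: first the vector of the numbers of
  brackets above the leaves \<open>1, 2, \<dots>\<close>, lexicographically, then the vector of the numbers of
  products above the leaves. Distributing a bracket over a product removes one argument from the
  bracket, so the left-hand sides of the Leibniz relations win at the first stage. Ties are broken by
  the same numbers for the last common vertex above two leaves; these determine the tree. Along a
  composition the numbers add, and the shuffle condition transports a first difference to a first
  difference, which gives \<open>monomial_ordering_poisson_order\<close>.

  The leading monomials of the relations are the six trees of
  \<open>leading_trees\<close>. A tree divisible by none of them is a right comb of products of trees \<open>B\<close>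
  made of brackets, where inside \<open>B\<close> any bracket \<open>{l, r}\<close> satisfies
  \<open>Min r < v\<close> for all leaves \<open>v\<close> of \<open>l\<close> but the least (\<open>normal_tree\<close>). Instead of reducing
  S-polynomials, the proof shows directly that no nonzero element of the ideal can have a normal
  leading monomial, by exhibiting for each normal tree \<open>t\<close> a linear functional that vanishes on the
  ideal and on all smaller trees but not on \<open>t\<close>.

  The functionals come from directed graphs \<open>E\<close> on the leaf labels (the configuration pairing of
  Lie trees with graphs, extended to products), whose loops are ignored: \<open>pairing E t\<close> is \<open>\<plusminus>1\<close> if sending an edge to the
  vertex of \<open>t\<close> at which its ends are separated is a bijection from the edges onto the brackets, and
  \<open>0\<close> otherwise. Only the numbers of edges between the blocks of a composition matter, so the
  associativity, Leibniz and Jacobi relations are checked on three blocks, and the vanishing on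
  the whole ideal follows since the pairing is multiplicative along compositions
  (\<open>generated_ideal_vanishing\<close>).

  For a normal tree \<open>t\<close> the graph \<open>edges t\<close> joins, at each bracket \<open>{l, r}\<close>, the least leaves of
  \<open>l\<close> and \<open>r\<close>. Suppose that a tree \<open>s\<close> pairs nontrivially with it. The number of brackets above
  a leaf \<open>v\<close> counts the edges whose cluster (the leaves below their separating vertex) contains
  \<open>v\<close>. By induction on \<open>v\<close>, as long as these numbers agree for \<open>s\<close> and \<open>t\<close> on smaller leaves, each
  cluster of \<open>t\<close> that contains \<open>v\<close> has its counterpart in \<open>s\<close> (\<open>cluster_mono\<close>); so at the first
  disagreement \<open>s\<close> has more brackets. If there is no disagreement, all clusters agree, the products
  of \<open>s\<close> are above its brackets, and among such trees the right comb has the fewest products above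
  the first leaf at which they differ (\<open>compare_count_Mu\<close>). Hence \<open>s\<close> is not smaller than \<open>t\<close>, which
  is \<open>pairing_edges_triangular\<close>.
\<close>

section \<open>Trees, relabelling and shuffle composition\<close>

lemma finite_leaves [simp]: "finite (leaves t)"
  by (induction t) auto

lemma leaves_nonempty [simp]: "leaves t \<noteq> {}"
  by (induction t) auto

lemma leaves_graft: "leaves (graft t us) = (\<Union>i\<in>leaves t. leaves (us i))"
  by (induction t) auto

lemma graft_cong: "(\<And>i. i \<in> leaves t \<Longrightarrow> us i = vs i) \<Longrightarrow> graft t us = graft t vs"
proof (induction t)
  case (Node g l r)
  have "graft l us = graft l vs" "graft r us = graft r vs"
    by (intro Node.IH Node.prems; simp)+
  then show ?case by simp
qed simp

lemma Min_image_strict_mono_on: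
  fixes h :: "nat \<Rightarrow> nat"
  assumes "strict_mono_on A h" "finite A" "A \<noteq> {}"
  shows "Min (h ` A) = h (Min A)"
proof (rule Min_eqI)
  fix y assume "y \<in> h ` A"
  then show "h (Min A) \<le> y"
    using Min_in[OF assms(2,3)] Min_le[OF assms(2)] strict_mono_on_leD[OF assms(1)] by blast
qed (use assms in auto)

lemma shuffle_tree_relabel:
  assumes "shuffle_tree t" "strict_mono_on (leaves t) h"
  shows "shuffle_tree (relabel h t)"
  using assms
proof (induction t)
  case (Node g l r)
  have mono: "strict_mono_on (leaves l) h" "strict_mono_on (leaves r) h"
    using Node.prems(2) by (auto intro: monotone_on_subset)
  have "inj_on h (leaves l \<union> leaves r)"
    using Node.prems(2) by (auto dest: strict_mono_on_imp_inj_on)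
  then have "h ` leaves l \<inter> h ` leaves r = {}"
    using Node.prems(1) by (simp flip: inj_on_image_Int)
  moreover have "h (Min (leaves l)) < h (Min (leaves r))"
    using Node.prems by (auto intro!: strict_mono_onD[OF Node.prems(2)])
  ultimately show ?case
    using Node mono by (simp add: optree.set_map Min_image_strict_mono_on)
qed simp

text \<open>The relabelling used by \<open>tree_comp\<close>, shifted so that positions start at 1.\<close>
definition enumerate_set :: "nat set \<Rightarrow> nat \<Rightarrow> nat" where
  "enumerate_set A j = sorted_list_of_set A ! (j - 1)"

lemma enumerate_set_strict_mono: "strict_mono_on {1..card A} (enumerate_set A)"
proof (rule strict_mono_onI)
  fix i j :: nat assume "i \<in> {1..card A}" "j \<in> {1..card A}" "i < j"
  then show "enumerate_set A i < enumerate_set A j"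
    unfolding enumerate_set_def
    by (intro sorted_wrt_nth_less[OF strict_sorted_list_of_set]) auto
qed

lemma enumerate_set_image:
  assumes "finite A"
  shows "enumerate_set A ` {1..card A} = A"
proof -
  have "enumerate_set A ` {1..card A} = (\<lambda>j. sorted_list_of_set A ! j) ` ((\<lambda>j. j - 1) ` {1..card A})"
    by (simp add: enumerate_set_def image_image)
  also have "(\<lambda>j. j - 1) ` {1..card A} = {0..<card A}"
  proof -
    have "(\<lambda>j. j - 1) ` {1..card A} = (\<lambda>j. j - Suc 0) ` Suc ` {0..<card A}"
      by (simp only: image_Suc_atLeastLessThan atLeastLessThanSuc_atLeastAtMost One_nat_def)
    then show ?thesis
      by (simp only: image_image diff_Suc_Suc minus_nat.diff_0 image_ident)
  qed
  also have "(\<lambda>j. sorted_list_of_set A ! j) ` {0..<card A} = set (sorted_list_of_set A)"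
    by (auto simp: set_conv_nth simp del: set_sorted_list_of_set)
  finally show ?thesis
    using assms by simp
qed

text \<open>The order-preserving relabelling of the leaves by \<open>1, \<dots>, k\<close>: it turns a subtree of a tree
  monomial into a tree monomial, and the relabelling inside \<open>tree_comp\<close> undoes it.\<close>
definition standardize :: "nat optree \<Rightarrow> nat optree" where
  "standardize t = relabel (the_inv_into {1..card (leaves t)} (enumerate_set (leaves t))) t"

lemma enumerate_set_inj: "inj_on (enumerate_set A) {1..card A}"
  by (rule strict_mono_on_imp_inj_on[OF enumerate_set_strict_mono])

lemma the_inv_into_enumerate_strict_mono:
  assumes "finite A"
  shows "strict_mono_on A (the_inv_into {1..card A} (enumerate_set A))" (is "strict_mono_on A ?g")
proof (rule strict_mono_onI)
  fix a b assume ab: "a \<in> A" "b \<in> A" "a < b"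
  have A: "x \<in> enumerate_set A ` {1..card A}" if "x \<in> A" for x
    using that enumerate_set_image[OF assms] by simp
  have in_dom: "?g x \<in> {1..card A}" and inv: "enumerate_set A (?g x) = x" if "x \<in> A" for x
    using the_inv_into_into[OF enumerate_set_inj A[OF that] subset_refl]
      f_the_inv_into_f[OF enumerate_set_inj A[OF that]] by auto
  show "?g a < ?g b"
  proof (rule ccontr)
    assume "\<not> ?g a < ?g b"
    then have "enumerate_set A (?g b) \<le> enumerate_set A (?g a)"
      using ab in_dom by (intro strict_mono_on_leD[OF enumerate_set_strict_mono]) auto
    then show False using ab inv by simp
  qed
qed

lemma standardize_in_tree_monomials:
  assumes "shuffle_tree t"
  shows "standardize t \<in> tree_monomials (card (leaves t))"
proof -
  have "the_inv_into {1..card (leaves t)} (enumerate_set (leaves t)) ` leaves t = {1..card (leaves t)}"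
    using the_inv_into_onto[OF enumerate_set_inj[of "leaves t"]]
    by (simp only: enumerate_set_image[OF finite_leaves])
  then show ?thesis
    using shuffle_tree_relabel[OF assms the_inv_into_enumerate_strict_mono[OF finite_leaves]]
    by (simp add: standardize_def tree_monomials_def optree.set_map)
qed

lemma relabel_enumerate_standardize: "relabel (enumerate_set (leaves t)) (standardize t) = t"
proof -
  have "relabel (enumerate_set (leaves t)) (standardize t) = relabel id t"
    unfolding standardize_def optree.map_comp
    using f_the_inv_into_f[OF enumerate_set_inj, of _ "leaves t"]
    by (intro optree.map_cong0) (simp only: enumerate_set_image[OF finite_leaves] o_apply id_apply)
  then show ?thesis by (simp add: optree.map_id)
qed

text \<open>The trees that \<open>tree_comp\<close> grafts, on their final labels. Working with these reduces every
  statement about compositions to one about plain grafting of trees with disjoint leaves.\<close>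
definition block_tree :: "nat \<Rightarrow> (nat \<Rightarrow> nat) \<Rightarrow> (nat \<Rightarrow> nat optree) \<Rightarrow> nat \<Rightarrow> nat optree" where
  "block_tree m f ts i = relabel (enumerate_set (fiber m f i)) (ts i)"

lemma tree_comp_eq_graft: "tree_comp m f t ts = graft t (block_tree m f ts)"
  by (simp add: tree_comp_def block_tree_def[abs_def] enumerate_set_def[abs_def])

lemma finite_fiber [simp]: "finite (fiber m f i)"
  by (simp add: fiber_def)

lemma shuffle_surj_fiber_nonempty:
  assumes "shuffle_surj m n f" "i \<in> {1..n}"
  shows "fiber m f i \<noteq> {}"
proof -
  have "i \<in> f ` {1..m}" using assms by (simp add: shuffle_surj_def)
  then show ?thesis by (auto simp: fiber_def)
qed

lemma shuffle_surj_in_range: "shuffle_surj m n f \<Longrightarrow> j \<in> {1..m} \<Longrightarrow> f j \<in> {1..n}"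
  by (auto simp: shuffle_surj_def)

lemma in_own_fiber: "j \<in> {1..m} \<Longrightarrow> j \<in> fiber m f (f j)"
  by (simp add: fiber_def)

lemma leaves_block_tree:
  assumes "ts i \<in> tree_monomials (card (fiber m f i))"
  shows "leaves (block_tree m f ts i) = fiber m f i"
  using assms enumerate_set_image[OF finite_fiber]
  by (simp add: block_tree_def tree_monomials_def optree.set_map)

lemma shuffle_tree_graft:
  assumes "shuffle_tree t"
    and "\<And>i. i \<in> leaves t \<Longrightarrow> shuffle_tree (us i)"
    and "\<And>i j. i \<in> leaves t \<Longrightarrow> j \<in> leaves t \<Longrightarrow> i \<noteq> j \<Longrightarrow> leaves (us i) \<inter> leaves (us j) = {}"
    and "\<And>i j. i \<in> leaves t \<Longrightarrow> j \<in> leaves t \<Longrightarrow> i < j \<Longrightarrow> Min (leaves (us i)) < Min (leaves (us j))"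
  shows "shuffle_tree (graft t us) \<and> Min (leaves (graft t us)) = Min (leaves (us (Min (leaves t))))"
  using assms
proof (induction t)
  case (Node g l r)
  have IHl: "shuffle_tree (graft l us)" "Min (leaves (graft l us)) = Min (leaves (us (Min (leaves l))))"
    using Node.IH(1) Node.prems by (auto simp del: Min_gr_iff)
  have IHr: "shuffle_tree (graft r us)" "Min (leaves (graft r us)) = Min (leaves (us (Min (leaves r))))"
    using Node.IH(2) Node.prems by (auto simp del: Min_gr_iff)
  have disj: "leaves l \<inter> leaves r = {}" and lt: "Min (leaves l) < Min (leaves r)"
    using Node.prems(1) by auto
  have "leaves (graft l us) \<inter> leaves (graft r us) = {}"
  proof -
    have "leaves (us i) \<inter> leaves (us j) = {}" if "i \<in> leaves l" "j \<in> leaves r" for i j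
      using Node.prems(3)[of i j] disj that by auto
    then show ?thesis
      by (simp add: leaves_graft disjoint_iff) blast
  qed
  moreover have less: "Min (leaves (us (Min (leaves l)))) < Min (leaves (us (Min (leaves r))))"
    using lt by (intro Node.prems(4)) simp_all
  moreover have "Min (leaves l \<union> leaves r) = Min (leaves l)"
    using lt by (simp add: Min_Un)
  moreover have "Min (leaves (graft l us) \<union> leaves (graft r us)) = Min (leaves (graft l us))"
    using less IHl IHr by (simp add: Min_Un)
  ultimately show ?case
    using IHl IHr by (simp del: Min_gr_iff)
qed simp

lemma shuffle_tree_block_tree:
  assumes "ts i \<in> tree_monomials (card (fiber m f i))"
  shows "shuffle_tree (block_tree m f ts i)"
  using assms enumerate_set_strict_mono[of "fiber m f i"]
  by (auto simp: block_tree_def tree_monomials_def intro: shuffle_tree_relabel)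

lemma tree_comp_in_tree_monomials:
  assumes f: "shuffle_surj m n f" and t: "t \<in> tree_monomials n"
    and ts: "\<forall>i\<in>{1..n}. ts i \<in> tree_monomials (card (fiber m f i))"
  shows "tree_comp m f t ts \<in> tree_monomials m"
proof -
  have L: "leaves t = {1..n}" "shuffle_tree t"
    using t by (auto simp: tree_monomials_def)
  have leaves: "leaves (block_tree m f ts i) = fiber m f i" if "i \<in> leaves t" for i
    using that ts L by (simp add: leaves_block_tree)
  have "shuffle_tree (graft t (block_tree m f ts))"
  proof (rule conjunct1[OF shuffle_tree_graft])
    fix i j assume "i \<in> leaves t" "j \<in> leaves t"
    then show "i \<noteq> j \<Longrightarrow> leaves (block_tree m f ts i) \<inter> leaves (block_tree m f ts j) = {}"
      and "i < j \<Longrightarrow> Min (leaves (block_tree m f ts i)) < Min (leaves (block_tree m f ts j))"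
      using f L(1) by (simp_all only: leaves shuffle_surj_def) (auto simp: fiber_def)
  next
    fix i assume "i \<in> leaves t"
    then show "shuffle_tree (block_tree m f ts i)"
      using ts L(1) shuffle_tree_block_tree by blast
  qed (rule L(2))
  moreover have "leaves (graft t (block_tree m f ts)) = {1..m}"
  proof -
    have "leaves (graft t (block_tree m f ts)) = (\<Union>i\<in>{1..n}. fiber m f i)"
      using leaves by (simp add: leaves_graft L)
    then show ?thesis
      using shuffle_surj_in_range[OF f] by (auto simp: fiber_def)
  qed
  ultimately show ?thesis
    by (simp add: tree_monomials_def tree_comp_eq_graft)
qed

text \<open>Grafting trees whose leaf sets partition \<open>{1..m}\<close>, listed by least leaf, is a composition of their
  standardizations. This is how a tree is decomposed at its root, or at its root and a neighbour.\<close>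
lemma graft_eq_tree_comp:
  assumes n: "1 \<le> n" and U: "\<And>i. i \<in> {1..n} \<Longrightarrow> shuffle_tree (U i)"
    and cover: "(\<Union>i\<in>{1..n}. leaves (U i)) = {1..m}"
    and disj: "\<And>i j. i \<in> {1..n} \<Longrightarrow> j \<in> {1..n} \<Longrightarrow> i < j \<Longrightarrow> leaves (U i) \<inter> leaves (U j) = {}"
    and less: "\<And>i j. i \<in> {1..n} \<Longrightarrow> j \<in> {1..n} \<Longrightarrow> i < j \<Longrightarrow> Min (leaves (U i)) < Min (leaves (U j))"
  obtains f where "shuffle_surj m n f"
    and "\<And>i. i \<in> {1..n} \<Longrightarrow> standardize (U i) \<in> tree_monomials (card (fiber m f i))"
    and "\<And>p. p \<in> tree_monomials n \<Longrightarrow> tree_comp m f p (\<lambda>i. standardize (U i)) = graft p U"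
proof -
  define f where "f a = (SOME i. i \<in> {1..n} \<and> a \<in> leaves (U i))" for a
  have f: "f a \<in> {1..n} \<and> a \<in> leaves (U (f a))" if "a \<in> {1..m}" for a
  proof -
    have "\<exists>i. i \<in> {1..n} \<and> a \<in> leaves (U i)"
      using that unfolding cover[symmetric] by blast
    then show ?thesis unfolding f_def by (rule someI_ex)
  qed
  have uniq: "f a = i" if "a \<in> leaves (U i)" "i \<in> {1..n}" for a i
  proof -
    have "a \<in> {1..m}" using that unfolding cover[symmetric] by blast
    from f[OF this] have fa: "f a \<in> {1..n}" "a \<in> leaves (U (f a))" by auto
    show ?thesis
    proof (rule linorder_cases)
      assume "f a < i"
      with disj[OF fa(1) that(2)] fa that show ?thesis by auto
    next
      assume "i < f a"
      with disj[OF that(2) fa(1)] fa that show ?thesis by auto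
    qed
  qed
  have fib: "fiber m f i = leaves (U i)" if "i \<in> {1..n}" for i
  proof -
    have "a \<in> {1..m}" if "a \<in> leaves (U i)" for a
      using that \<open>i \<in> {1..n}\<close> unfolding cover[symmetric] by blast
    then show ?thesis
      using that uniq f unfolding fiber_def by blast
  qed
  have "f ` {1..m} = {1..n}"
  proof
    show "{1..n} \<subseteq> f ` {1..m}"
    proof
      fix i assume i: "i \<in> {1..n}"
      obtain a where "a \<in> leaves (U i)" using leaves_nonempty[of "U i"] by blast
      then show "i \<in> f ` {1..m}" using i uniq unfolding cover[symmetric] by blast
    qed
  qed (use f in blast)
  then have "shuffle_surj m n f"
    using n less by (auto simp: shuffle_surj_def fib)
  moreover have "standardize (U i) \<in> tree_monomials (card (fiber m f i))" if "i \<in> {1..n}" for i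
    using standardize_in_tree_monomials U fib that by simp
  moreover have "tree_comp m f p (\<lambda>i. standardize (U i)) = graft p U" if "p \<in> tree_monomials n" for p
  proof -
    have block: "block_tree m f (\<lambda>i. standardize (U i)) i = U i" if "i \<in> {1..n}" for i
      using that by (simp add: block_tree_def fib relabel_enumerate_standardize)
    have "graft p (block_tree m f (\<lambda>i. standardize (U i))) = graft p U"
      using that by (intro graft_cong block) (simp add: tree_monomials_def)
    then show ?thesis
      by (simp only: tree_comp_eq_graft)
  qed
  ultimately show ?thesis by (rule that)
qed

section \<open>The monomial ordering\<close>

text \<open>The number of vertices labelled \<open>g\<close> strictly above the last common vertex of the leaves
  \<open>i\<close> and \<open>j\<close>. For \<open>i = j\<close> this is the number of such vertices on the path from the root to the leaf.
  The value for labels outside the tree is 0, so two trees with the same leaves agree there.\<close>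
primrec count_above :: "gen \<Rightarrow> nat optree \<Rightarrow> nat \<Rightarrow> nat \<Rightarrow> nat" where
  "count_above g (Leaf a) i j = 0"
| "count_above g (Node h l r) i j =
     (if i \<in> leaves l \<and> j \<in> leaves l then of_bool (g = h) + count_above g l i j
      else if i \<in> leaves r \<and> j \<in> leaves r then of_bool (g = h) + count_above g r i j
      else 0)"

lemma count_above_outside:
  "i \<notin> leaves t \<or> j \<notin> leaves t \<Longrightarrow> count_above g t i j = 0"
  by (cases t) auto

lemma count_above_relabel:
  assumes "inj_on h (leaves t)" "i \<in> leaves t" "j \<in> leaves t"
  shows "count_above g (relabel h t) (h i) (h j) = count_above g t i j"
  using assms
proof (induction t)
  case (Node g' l r)
  have "inj_on h (leaves l)" "inj_on h (leaves r)"
    using Node.prems(1) by (auto intro: inj_on_subset)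
  moreover have "h k \<in> h ` leaves l \<longleftrightarrow> k \<in> leaves l" "h k \<in> h ` leaves r \<longleftrightarrow> k \<in> leaves r"
    if "k \<in> leaves l \<union> leaves r" for k
    using that Node.prems(1) by (auto dest: inj_onD)
  ultimately show ?case
    using Node by (simp add: optree.set_map)
qed simp

text \<open>The path to a common vertex of two leaves runs through the outer tree, and continues into a
  grafted tree exactly when both leaves lie in the same one.\<close>
lemma count_above_graft:
  assumes "shuffle_tree t"
    and "\<And>a b. a \<in> leaves t \<Longrightarrow> b \<in> leaves t \<Longrightarrow> a \<noteq> b \<Longrightarrow> leaves (us a) \<inter> leaves (us b) = {}"
    and "a \<in> leaves t" "b \<in> leaves t" "j \<in> leaves (us a)" "k \<in> leaves (us b)"
  shows "count_above g (graft t us) j k =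
    count_above g t a b + (if a = b then count_above g (us a) j k else 0)"
  using assms
proof (induction t)
  case (Node h l r)
  have iff: "i \<in> leaves (graft q us) \<longleftrightarrow> c \<in> leaves q"
    if "i \<in> leaves (us c)" "c \<in> leaves l \<union> leaves r" "leaves q \<subseteq> leaves l \<union> leaves r" for i c q
    using that Node.prems(2) by (auto simp: leaves_graft disjoint_iff)
  have "leaves l \<inter> leaves r = {}" using Node.prems(1) by simp
  moreover have "j \<in> leaves (graft l us) \<longleftrightarrow> a \<in> leaves l" "j \<in> leaves (graft r us) \<longleftrightarrow> a \<in> leaves r"
    "k \<in> leaves (graft l us) \<longleftrightarrow> b \<in> leaves l" "k \<in> leaves (graft r us) \<longleftrightarrow> b \<in> leaves r"
    using iff Node.prems(3-6) by auto
  moreover have "a \<in> leaves l \<Longrightarrow> b \<in> leaves l \<Longrightarrow> count_above g (graft l us) j k =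
      count_above g l a b + (if a = b then count_above g (us a) j k else 0)"
    using Node.prems by (intro Node.IH(1)) auto
  moreover have "a \<in> leaves r \<Longrightarrow> b \<in> leaves r \<Longrightarrow> count_above g (graft r us) j k =
      count_above g r a b + (if a = b then count_above g (us a) j k else 0)"
    using Node.prems by (intro Node.IH(2)) auto
  ultimately show ?case
    using Node.prems(3,4) by auto
qed simp

text \<open>Every tree has two leaves, equal for a single leaf, whose last common vertex is the root. It lets the
  label of a vertex be read off from the numbers of vertices above its child.\<close>
lemma exists_topmost: "\<exists>i\<in>leaves t. \<exists>j\<in>leaves t. \<forall>g. shuffle_tree t \<longrightarrow> count_above g t i j = 0"
proof (cases t)
  case (Node g l r)
  obtain i j where "i \<in> leaves l" "j \<in> leaves r"
    using leaves_nonempty[of l] leaves_nonempty[of r] by blast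
  then show ?thesis
    using Node by (intro bexI[of _ i] bexI[of _ j]) auto
qed auto

text \<open>The least leaf lies in the left subtree, so the left subtree consists of the leaves that have a
  common vertex with it below the root.\<close>
lemma left_leaves_iff:
  assumes "shuffle_tree (Node g l r)"
  shows "j \<in> leaves l \<longleftrightarrow> j \<in> leaves (Node g l r) \<and>
    (\<exists>h. count_above h (Node g l r) (Min (leaves (Node g l r))) j > 0)"
proof -
  have Min: "Min (leaves l \<union> leaves r) = Min (leaves l)"
    using assms by (simp add: Min_Un del: Min_gr_iff)
  have "Min (leaves l) \<in> leaves l" "Min (leaves l) \<notin> leaves r"
    using assms Min_in[OF finite_leaves leaves_nonempty, of l] by auto
  then show ?thesis
    using assms by (auto simp: Min simp del: Min_gr_iff)
qed

lemma left_leaves_determined: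
  assumes s: "shuffle_tree (Node g l r)" and t: "shuffle_tree (Node g' l' r')"
    and leaves_eq: "leaves (Node g l r) = leaves (Node g' l' r')"
    and eq: "\<And>h i j. i \<in> leaves (Node g l r) \<Longrightarrow> j \<in> leaves (Node g l r) \<Longrightarrow>
      count_above h (Node g l r) i j = count_above h (Node g' l' r') i j"
  shows "leaves l = leaves l'"
proof -
  have M: "Min (leaves (Node g l r)) \<in> leaves (Node g l r)"
    by (intro Min_in finite_leaves leaves_nonempty)
  have "(\<exists>h. count_above h (Node g l r) (Min (leaves (Node g l r))) j > 0) \<longleftrightarrow>
      (\<exists>h. count_above h (Node g' l' r') (Min (leaves (Node g' l' r'))) j > 0)"
    if "j \<in> leaves (Node g l r)" for j
    by (subst eq[OF M that], subst leaves_eq) (rule HOL.refl)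
  then have "j \<in> leaves l \<longleftrightarrow> j \<in> leaves l'" for j
    unfolding left_leaves_iff[OF s, of j] left_leaves_iff[OF t, of j] leaves_eq[symmetric]
    by (rule conj_cong[OF HOL.refl])
  then show ?thesis by blast
qed

text \<open>The left and right leaf sets are known by the previous lemma; the label of the root is the only
  vertex counted above the root of the left subtree.\<close>
lemma count_above_determines_tree:
  assumes "shuffle_tree s" "shuffle_tree t" "leaves s = leaves t"
    and "\<And>g i j. i \<in> leaves s \<Longrightarrow> j \<in> leaves s \<Longrightarrow> count_above g s i j = count_above g t i j"
  shows "s = t"
  using assms
proof (induction s arbitrary: t)
  case (Leaf a)
  show ?case
  proof (cases t)
    case (Node g l r)
    then have "leaves l \<subseteq> {a}" "leaves r \<subseteq> {a}" "leaves l \<inter> leaves r = {}"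
      using Leaf.prems by auto
    then show ?thesis
      using leaves_nonempty[of l] leaves_nonempty[of r] by blast
  qed (use Leaf in auto)
next
  case (Node g l r)
  note eq = Node.prems(4) and leaves_eq = Node.prems(3)
  show ?case
  proof (cases t)
    case (Leaf a)
    then have "leaves l \<subseteq> {a}" "leaves r \<subseteq> {a}" "leaves l \<inter> leaves r = {}"
      using Node.prems by auto
    then show ?thesis
      using leaves_nonempty[of l] leaves_nonempty[of r] by blast
  next
    case t: (Node g' l' r')
    have "leaves l = leaves l'"
    proof (rule left_leaves_determined)
      show "shuffle_tree (Node g l r)" "shuffle_tree (Node g' l' r')"
        "leaves (Node g l r) = leaves (Node g' l' r')"
        using Node.prems(1-3) t by simp_all
      show "count_above h (Node g l r) i j = count_above h (Node g' l' r') i j"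
        if "i \<in> leaves (Node g l r)" "j \<in> leaves (Node g l r)" for h i j
        using eq[OF that] t by simp
    qed
    moreover have disj: "leaves l \<inter> leaves r = {}" "leaves l' \<inter> leaves r' = {}"
      using Node.prems(1,2) t by auto
    ultimately have L: "leaves l = leaves l'" and R: "leaves r = leaves r'"
      using leaves_eq t by auto
    have sub: "shuffle_tree l" "shuffle_tree r" "shuffle_tree l'" "shuffle_tree r'"
      using Node.prems(1,2) t by auto
    obtain i j where ij: "i \<in> leaves l" "j \<in> leaves l" "\<And>h. count_above h l i j = 0"
      using exists_topmost[of l] sub by blast
    have "count_above g' (Node g l r) i j = of_bool (g' = g)"
      using ij by simp
    moreover have "count_above g' t i j = Suc (count_above g' l' i j)"
      using ij(1,2) unfolding L t by simp
    moreover have "count_above g' (Node g l r) i j = count_above g' t i j"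
      using ij(1,2) by (intro eq) simp_all
    ultimately have "g = g'"
      by (cases "g' = g") simp_all
    moreover have "l = l'"
    proof (rule Node.IH(1)[OF sub(1,3) L])
      fix h i j assume "i \<in> leaves l" "j \<in> leaves l"
      then show "count_above h l i j = count_above h l' i j"
        using eq[of i j h] L t \<open>g = g'\<close> by simp
    qed
    moreover have "r = r'"
    proof (rule Node.IH(2)[OF sub(2,4) R])
      fix h i j assume "i \<in> leaves r" "j \<in> leaves r"
      then show "count_above h r i j = count_above h r' i j"
        using eq[of i j h] L R t \<open>g = g'\<close> disj by auto
    qed
    ultimately show ?thesis
      using t by simp
  qed
qed

text \<open>The lexicographic order of functions on a well-order; well-foundedness of the index set makes it total.\<close>
definition first_diff_less :: "('a::wellorder \<Rightarrow> nat) \<Rightarrow> ('a \<Rightarrow> nat) \<Rightarrow> bool" where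
  "first_diff_less x y \<longleftrightarrow> (\<exists>p. x p < y p \<and> (\<forall>q<p. x q = y q))"

lemma triple_less_iff:
  "(d, x, y) < (c, a, b) \<longleftrightarrow> d < c \<or> d = c \<and> (x < a \<or> x = a \<and> y < b)"
  for a b c d x y :: "'a::linorder"
  by (auto simp: less_prod_def less_eq_prod_def)

lemma first_diff_less_triple:
  assumes "first_diff_less x y"
  shows "\<exists>c a b. x (c, a, b) < y (c, a, b) \<and> (\<forall>q<(c, a, b). x q = y q)"
  using assms unfolding first_diff_less_def by (metis prod_cases3)

lemma first_diff_less_irrefl: "\<not> first_diff_less x x"
  by (simp add: first_diff_less_def)

lemma first_diff_less_trans:
  assumes "first_diff_less x y" "first_diff_less y z"
  shows "first_diff_less x z"
proof -
  obtain p q where p: "x p < y p" "\<And>i. i < p \<Longrightarrow> x i = y i"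
    and q: "y q < z q" "\<And>i. i < q \<Longrightarrow> y i = z i"
    using assms unfolding first_diff_less_def by blast
  show ?thesis
    unfolding first_diff_less_def
  proof (intro exI[of _ "min p q"] conjI allI impI)
    show "x (min p q) < z (min p q)"
      using p q by (cases p q rule: linorder_cases) (auto simp: min_def)
  qed (use p q in auto)
qed

lemma first_diff_less_total:
  assumes "x \<noteq> y"
  shows "first_diff_less x y \<or> first_diff_less y x"
proof -
  define p where "p = (LEAST p. x p \<noteq> y p)"
  have "\<exists>p. x p \<noteq> y p" using assms by auto
  then have "x p \<noteq> y p" unfolding p_def by (rule LeastI_ex)
  moreover have "x q = y q" if "q < p" for q
    using not_less_Least[of q "\<lambda>p. x p \<noteq> y p"] that by (simp add: p_def)
  ultimately show ?thesis
    unfolding first_diff_less_def by (metis linorder_neqE_nat)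
qed

text \<open>The first component of the index is the stage of the comparison. In stages 0 and 1 only the
  diagonal \<open>i = j\<close> counts; stages 2 and 3 break ties.\<close>
fun key :: "nat optree \<Rightarrow> nat \<times> nat \<times> nat \<Rightarrow> nat" where
  "key t (c, i, j) =
     (if c = 0 then (if i = j then count_above Lam t i j else 0)
      else if c = 1 then (if i = j then count_above Mu t i j else 0)
      else if c = 2 then count_above Lam t i j
      else if c = 3 then count_above Mu t i j
      else 0)"

lemma key_determines_tree:
  assumes "s \<in> tree_monomials n" "t \<in> tree_monomials n" "key s = key t"
  shows "s = t"
proof (rule count_above_determines_tree)
  fix g i j
  show "count_above g s i j = count_above g t i j"
    using fun_cong[OF assms(3), of "(2, i, j)"] fun_cong[OF assms(3), of "(3, i, j)"]
    by (cases g) simp_all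
qed (use assms in \<open>auto simp: tree_monomials_def\<close>)

definition poisson_order :: "nat \<Rightarrow> nat optree rel" where
  "poisson_order n = {(s, t). s \<in> tree_monomials n \<and> t \<in> tree_monomials n \<and>
     (s = t \<or> first_diff_less (key s) (key t))}"

lemma poisson_order_strict_iff:
  "(s, t) \<in> poisson_order n - Id \<longleftrightarrow>
     s \<in> tree_monomials n \<and> t \<in> tree_monomials n \<and> first_diff_less (key s) (key t)"
  using first_diff_less_irrefl by (auto simp: poisson_order_def)

lemma linear_order_poisson_order: "linear_order_on (tree_monomials n) (poisson_order n)"
  unfolding linear_order_on_def partial_order_on_def preorder_on_def
proof (intro conjI)
  show "trans (poisson_order n)"
    by (rule transI) (auto simp: poisson_order_def dest: first_diff_less_trans)
  show "antisym (poisson_order n)"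
    by (rule antisymI)
      (auto simp: poisson_order_def first_diff_less_irrefl dest: first_diff_less_trans)
  show "total_on (tree_monomials n) (poisson_order n)"
  proof (rule total_onI)
    fix s t assume "s \<in> tree_monomials n" "t \<in> tree_monomials n" "s \<noteq> t"
    moreover from this have "key s \<noteq> key t" using key_determines_tree by blast
    ultimately show "(s, t) \<in> poisson_order n \<or> (t, s) \<in> poisson_order n"
      using first_diff_less_total by (auto simp: poisson_order_def)
  qed
qed (auto simp: poisson_order_def refl_on_def)

lemma count_above_tree_comp:
  assumes "shuffle_surj m n f" "t \<in> tree_monomials n"
    and "\<forall>i\<in>{1..n}. ts i \<in> tree_monomials (card (fiber m f i))"
    and "j \<in> {1..m}" "k \<in> {1..m}"
  shows "count_above g (tree_comp m f t ts) j k =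
    count_above g t (f j) (f k) +
    (if f j = f k then count_above g (block_tree m f ts (f j)) j k else 0)"
  unfolding tree_comp_eq_graft
proof (rule count_above_graft)
  have L: "leaves t = {1..n}" "shuffle_tree t"
    using assms(2) by (auto simp: tree_monomials_def)
  show "shuffle_tree t" by (rule L(2))
  have leaves: "leaves (block_tree m f ts i) = fiber m f i" if "i \<in> {1..n}" for i
    using assms(3) that leaves_block_tree by blast
  show "f j \<in> leaves t" "f k \<in> leaves t"
    unfolding L using assms(1,4,5) shuffle_surj_in_range by blast+
  then show "j \<in> leaves (block_tree m f ts (f j))" "k \<in> leaves (block_tree m f ts (f k))"
    unfolding L using leaves assms(4,5) in_own_fiber by blast+
  fix a b assume "a \<in> leaves t" "b \<in> leaves t" "a \<noteq> b"
  then show "leaves (block_tree m f ts a) \<inter> leaves (block_tree m f ts b) = {}"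
    unfolding L by (simp only: leaves) (auto simp: fiber_def)
qed

lemma key_outside:
  assumes "t \<in> tree_monomials n" "i \<notin> {1..n} \<or> j \<notin> {1..n}"
  shows "key t (c, i, j) = 0"
proof -
  have "count_above g t i j = 0" for g
    using assms by (intro count_above_outside) (auto simp: tree_monomials_def)
  then show ?thesis by auto
qed

lemma Min_fiber:
  assumes "shuffle_surj m n f" "a \<in> {1..n}"
  shows "Min (fiber m f a) \<in> {1..m}" "f (Min (fiber m f a)) = a"
  using Min_in[OF finite_fiber shuffle_surj_fiber_nonempty[OF assms]]
  by (auto simp: fiber_def)

text \<open>The least leaves of the blocks increase, so a leaf that precedes the least leaf of block \<open>a\<close> lies in
  an earlier block.\<close>
lemma less_Min_fiber:
  assumes "shuffle_surj m n f" "a \<in> {1..n}" "j \<in> {1..m}" "j < Min (fiber m f a)"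
  shows "f j < a"
proof (rule ccontr)
  assume "\<not> f j < a"
  then have "Min (fiber m f a) \<le> Min (fiber m f (f j))"
    using assms shuffle_surj_in_range[OF assms(1,3)] unfolding shuffle_surj_def
    by (cases "f j = a") (auto simp del: Min_gr_iff simp: less_imp_le)
  also have "\<dots> \<le> j"
    using assms(3) by (intro Min_le) (auto simp: fiber_def)
  finally show False using assms(4) by simp
qed

text \<open>If \<open>t\<close> and \<open>t'\<close> first differ at \<open>(a, b)\<close>, the composites first differ at the least leaves of the
  blocks \<open>a\<close> and \<open>b\<close>: the contribution of the grafted trees is the same on both sides, and all smaller
  positions of the composite come from smaller positions of the outer trees.\<close>
lemma tree_comp_mono_root:
  assumes f: "shuffle_surj m n f" and ts: "\<forall>i\<in>{1..n}. ts i \<in> tree_monomials (card (fiber m f i))"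
    and less: "(t, t') \<in> poisson_order n - Id"
  shows "(tree_comp m f t ts, tree_comp m f t' ts) \<in> poisson_order m - Id"
proof -
  let ?s = "tree_comp m f t ts" and ?s' = "tree_comp m f t' ts"
  have t: "t \<in> tree_monomials n" "t' \<in> tree_monomials n" "first_diff_less (key t) (key t')"
    using less[unfolded poisson_order_strict_iff] by blast+
  have s: "?s \<in> tree_monomials m" "?s' \<in> tree_monomials m"
    using tree_comp_in_tree_monomials f t ts by blast+
  obtain c a b where diff: "key t (c, a, b) < key t' (c, a, b)"
    and before: "\<And>q. q < (c, a, b) \<Longrightarrow> key t q = key t' q"
    using first_diff_less_triple[OF t(3)] by blast
  have ab: "a \<in> {1..n}" "b \<in> {1..n}"
    using key_outside[OF t(1), of a b c] key_outside[OF t(2), of a b c] diff by (metis less_irrefl)+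
  have transfer: "key ?s (d, j, k) < key ?s' (d, j, k) \<longleftrightarrow> key t (d, f j, f k) < key t' (d, f j, f k)"
      "key ?s (d, j, k) = key ?s' (d, j, k) \<longleftrightarrow> key t (d, f j, f k) = key t' (d, f j, f k)"
    if "j \<in> {1..m}" "k \<in> {1..m}" "j = k \<or> d \<noteq> 0 \<and> d \<noteq> 1" for d j k
    using that by (auto simp: count_above_tree_comp[OF f _ ts] t)
  let ?j = "Min (fiber m f a)" and ?k = "Min (fiber m f b)"
  note jk = Min_fiber[OF f ab(1)] Min_fiber[OF f ab(2)]
  have diag: "a = b \<or> c \<noteq> 0 \<and> c \<noteq> 1"
    using diff by (auto split: if_splits)
  have "first_diff_less (key ?s) (key ?s')"
    unfolding first_diff_less_def
  proof (intro exI[of _ "(c, ?j, ?k)"] conjI allI impI)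
    show "key ?s (c, ?j, ?k) < key ?s' (c, ?j, ?k)"
      using diff diag jk by (subst transfer(1)) auto
  next
    fix q assume "q < (c, ?j, ?k)"
    obtain d j k where q: "q = (d, j, k)" by (cases q) auto
    show "key ?s q = key ?s' q"
    proof (cases "j \<in> {1..m} \<and> k \<in> {1..m} \<and> (j = k \<or> d \<noteq> 0 \<and> d \<noteq> 1)")
      case True
      have "(d, f j, f k) < (c, a, b)"
        using \<open>q < (c, ?j, ?k)\<close> True jk less_Min_fiber[OF f ab(1), of j] less_Min_fiber[OF f ab(2), of k]
        by (auto simp: q triple_less_iff simp del: Min_gr_iff less_prod_simp)
      then show ?thesis
        unfolding q using True transfer(2)[of j k d] before by blast
    next
      case False
      then show ?thesis
        unfolding q using key_outside[OF s(1), of j k d] key_outside[OF s(2), of j k d] by auto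
    qed
  qed
  then show ?thesis
    unfolding poisson_order_strict_iff using s by blast
qed

text \<open>Only pairs of leaves in the block \<open>i\<close> see the change, and the relabelling of a block preserves the
  order of its leaves, hence the position of the first difference.\<close>
lemma tree_comp_mono_arg:
  assumes f: "shuffle_surj m n f" and t: "t \<in> tree_monomials n"
    and ts: "\<forall>i\<in>{1..n}. ts i \<in> tree_monomials (card (fiber m f i))" and i: "i \<in> {1..n}"
    and less: "(ts i, u) \<in> poisson_order (card (fiber m f i)) - Id"
  shows "(tree_comp m f t ts, tree_comp m f t (ts(i := u))) \<in> poisson_order m - Id"
proof -
  let ?s = "tree_comp m f t ts" and ?s' = "tree_comp m f t (ts(i := u))"
  let ?K = "{1..card (fiber m f i)}" and ?h = "enumerate_set (fiber m f i)"
  have u: "ts i \<in> tree_monomials (card (fiber m f i))" "u \<in> tree_monomials (card (fiber m f i))"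
    "first_diff_less (key (ts i)) (key u)"
    using less[unfolded poisson_order_strict_iff] by blast+
  have ts': "\<forall>j\<in>{1..n}. (ts(i := u)) j \<in> tree_monomials (card (fiber m f j))"
    using ts u by simp
  have s: "?s \<in> tree_monomials m" "?s' \<in> tree_monomials m"
    using tree_comp_in_tree_monomials f t ts ts' by blast+
  obtain c a b where diff: "key (ts i) (c, a, b) < key u (c, a, b)"
    and before: "\<And>q. q < (c, a, b) \<Longrightarrow> key (ts i) q = key u q"
    using first_diff_less_triple[OF u(3)] by blast
  have ab: "a \<in> ?K" "b \<in> ?K"
    using key_outside[OF u(1), of a b c] key_outside[OF u(2), of a b c] diff by (metis less_irrefl)+
  have h: "?h x \<in> {1..m}" "f (?h x) = i" if "x \<in> ?K" for x
  proof -
    have "?h x \<in> fiber m f i"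
      using that enumerate_set_image[OF finite_fiber, of m f i] by blast
    then show "?h x \<in> {1..m}" "f (?h x) = i" by (simp_all add: fiber_def)
  qed
  have count_eq: "count_above g ?s j k = count_above g ?s' j k"
    if "j \<in> {1..m}" "k \<in> {1..m}" "f j \<noteq> i \<or> f k \<noteq> i" for g j k
    using that by (auto simp: count_above_tree_comp[OF f t ts] count_above_tree_comp[OF f t ts']
        block_tree_def)
  have count_block: "count_above g ?s (?h x) (?h y) = count_above g t i i + count_above g (ts i) x y"
      "count_above g ?s' (?h x) (?h y) = count_above g t i i + count_above g u x y"
    if "x \<in> ?K" "y \<in> ?K" for g x y
  proof -
    have "count_above g (relabel ?h v) (?h x) (?h y) = count_above g v x y"
      if "v \<in> tree_monomials (card (fiber m f i))" for v
      using that \<open>x \<in> ?K\<close> \<open>y \<in> ?K\<close> enumerate_set_inj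
      by (intro count_above_relabel) (auto simp: tree_monomials_def)
    then show "count_above g ?s (?h x) (?h y) = count_above g t i i + count_above g (ts i) x y"
      "count_above g ?s' (?h x) (?h y) = count_above g t i i + count_above g u x y"
      using that h u by (simp_all add: count_above_tree_comp[OF f t ts] count_above_tree_comp[OF f t ts']
        block_tree_def del: atLeastAtMost_iff)
  qed
  have transfer: "key ?s (d, ?h x, ?h y) < key ?s' (d, ?h x, ?h y) \<longleftrightarrow> key (ts i) (d, x, y) < key u (d, x, y)"
      "key ?s (d, ?h x, ?h y) = key ?s' (d, ?h x, ?h y) \<longleftrightarrow> key (ts i) (d, x, y) = key u (d, x, y)"
    if "x \<in> ?K" "y \<in> ?K" "x = y \<or> d \<noteq> 0 \<and> d \<noteq> 1" for d x y
    using that(3) count_block[OF that(1,2)] by auto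
  have h_less: "x < y" if "?h x < ?h y" "x \<in> ?K" "y \<in> ?K" for x y
    using that strict_mono_on_leD[OF enumerate_set_strict_mono, of y "fiber m f i" x]
    by (meson not_le)
  have h_inj: "x = y" if "?h x = ?h y" "x \<in> ?K" "y \<in> ?K" for x y
    using that enumerate_set_inj by (blast dest: inj_onD)
  have diag: "a = b \<or> c \<noteq> 0 \<and> c \<noteq> 1"
    using diff by (auto split: if_splits)
  have "first_diff_less (key ?s) (key ?s')"
    unfolding first_diff_less_def
  proof (intro exI[of _ "(c, ?h a, ?h b)"] conjI allI impI)
    show "key ?s (c, ?h a, ?h b) < key ?s' (c, ?h a, ?h b)"
      using diff diag ab by (subst transfer(1)) auto
  next
    fix q assume q_less: "q < (c, ?h a, ?h b)"
    obtain d j k where q: "q = (d, j, k)" by (cases q) auto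
    show "key ?s q = key ?s' q"
    proof (cases "j \<in> {1..m} \<and> k \<in> {1..m}")
      case True
      show ?thesis
      proof (cases "f j = i \<and> f k = i")
        case fi: True
        then have "j \<in> fiber m f i" "k \<in> fiber m f i"
          using True by (auto simp: fiber_def)
        then obtain x y where xy: "x \<in> ?K" "y \<in> ?K" "j = ?h x" "k = ?h y"
          using enumerate_set_image[OF finite_fiber, of m f i] by (metis imageE)
        have "(d, x, y) < (c, a, b)"
          using q_less h_less h_inj xy ab
          by (auto simp: q triple_less_iff simp del: atLeastAtMost_iff less_prod_simp)
        then have "key (ts i) (d, x, y) = key u (d, x, y)"
          by (rule before)
        then show ?thesis
          unfolding q xy using h_inj[OF _ xy(1,2)] transfer(2)[OF xy(1,2), of d]
          by (cases "x = y \<or> d \<noteq> 0 \<and> d \<noteq> 1") auto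
      next
        case False
        have "count_above g ?s j k = count_above g ?s' j k" for g
          using True False by (intro count_eq) auto
        then show ?thesis
          unfolding q by auto
      qed
    next
      case False
      then show ?thesis
        unfolding q using key_outside[OF s(1), of j k d] key_outside[OF s(2), of j k d] by auto
    qed
  qed
  then show ?thesis
    unfolding poisson_order_strict_iff using s by blast
qed

lemma monomial_ordering_poisson_order: "monomial_ordering poisson_order"
  unfolding monomial_ordering_def
  using linear_order_poisson_order tree_comp_mono_root tree_comp_mono_arg by blast

section \<open>Pairing trees with directed graphs\<close>

text \<open>Graphs are lists of directed edges, so that edges may be repeated: identifying vertices, as
  needed below for the outer tree of a composition, can create multiple edges and loops.\<close>
definition arrows :: "(nat \<times> nat) list \<Rightarrow> nat set \<Rightarrow> nat set \<Rightarrow> nat" where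
  "arrows E A B = length (filter (\<lambda>(a, b). a \<in> A \<and> b \<in> B) E)"

text \<open>The weight of a vertex from the numbers of edges going from left to right and from right to left.
  The sign for a reversed edge makes the bracket skew-symmetric.\<close>
fun vertex_weight :: "gen \<Rightarrow> nat \<Rightarrow> nat \<Rightarrow> 'k::field" where
  "vertex_weight Mu x y = (if x = 0 \<and> y = 0 then 1 else 0)"
| "vertex_weight Lam x y = (if x = 1 \<and> y = 0 then 1 else if x = 0 \<and> y = 1 then -1 else 0)"

primrec pairing :: "(nat \<times> nat) list \<Rightarrow> nat optree \<Rightarrow> 'k::field" where
  "pairing E (Leaf a) = 1"
| "pairing E (Node g l r) =
     vertex_weight g (arrows E (leaves l) (leaves r)) (arrows E (leaves r) (leaves l)) *
     pairing E l * pairing E r"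

lemma arrows_Un_left: "A \<inter> B = {} \<Longrightarrow> arrows E (A \<union> B) C = arrows E A C + arrows E B C"
  unfolding arrows_def by (induction E) auto

lemma arrows_Un_right: "A \<inter> B = {} \<Longrightarrow> arrows E C (A \<union> B) = arrows E C A + arrows E C B"
  unfolding arrows_def by (induction E) auto

text \<open>The graph seen through a partial map of labels with domain \<open>D\<close>; edges that leave \<open>D\<close> are dropped.\<close>
definition pull :: "nat set \<Rightarrow> (nat \<Rightarrow> nat) \<Rightarrow> (nat \<times> nat) list \<Rightarrow> (nat \<times> nat) list" where
  "pull D g E = map (map_prod g g) (filter (\<lambda>(a, b). a \<in> D \<and> b \<in> D) E)"

lemma arrows_pull:
  "arrows (pull D g E) A B = arrows E {a \<in> D. g a \<in> A} {a \<in> D. g a \<in> B}"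
  unfolding arrows_def pull_def by (induction E) auto

lemma pairing_cong:
  assumes "filter (\<lambda>(a, b). a \<in> leaves t \<and> b \<in> leaves t) E =
    filter (\<lambda>(a, b). a \<in> leaves t \<and> b \<in> leaves t) E'"
  shows "pairing E t = (pairing E' t :: 'k::field)"
proof -
  have restrict: "arrows E A B = arrows (filter (\<lambda>(a, b). a \<in> C \<and> b \<in> C) E) A B"
    if "A \<subseteq> C" "B \<subseteq> C" for A B C E
    unfolding arrows_def filter_filter
    by (rule arg_cong[of _ _ length], rule filter_cong) (use that in auto)
  have "pairing E s = (pairing E' s :: 'k)" if "leaves s \<subseteq> leaves t" for s
    using that
  proof (induction s)
    case (Node g l r)
    have "arrows E A B = arrows E' A B" if "A \<subseteq> leaves t" "B \<subseteq> leaves t" for A B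
      using restrict[OF that, of E] restrict[OF that, of E'] assms by simp
    then show ?case
      using Node by simp
  qed simp
  then show ?thesis by simp
qed

text \<open>The vertices of the outer tree separate whole blocks, so they see the graph with each block
  contracted to a point; the remaining vertices lie inside single blocks.\<close>
lemma pairing_graft:
  assumes "\<And>i. i \<in> leaves t \<Longrightarrow> leaves (us i) = {a \<in> D. f a = i}"
  shows "shuffle_tree t \<Longrightarrow>
    pairing E (graft t us) =
      (pairing (pull D f E) t * (\<Prod>i\<in>leaves t. pairing E (us i)) :: 'k::field)"
  using assms
proof (induction t)
  case (Node g l r)
  have leaves: "leaves (graft s us) = {a \<in> D. f a \<in> leaves s}" if "leaves s \<subseteq> leaves l \<union> leaves r" for s
    using that Node.prems(2) by (auto simp: leaves_graft)
  have "(\<Prod>i\<in>leaves l \<union> leaves r. pairing E (us i)) =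
      (\<Prod>i\<in>leaves l. pairing E (us i)) * (\<Prod>i\<in>leaves r. pairing E (us i) :: 'k)"
    using Node.prems(1) by (intro prod.union_disjoint) auto
  then show ?case
    using Node by (simp add: arrows_pull leaves mult_ac)
qed simp

text \<open>The hypothesis says that \<open>g\<close>, defined on \<open>D\<close>, inverts \<open>h\<close>.\<close>
lemma pairing_relabel:
  assumes "\<And>A. A \<subseteq> leaves t \<Longrightarrow> h ` A = {a \<in> D. g a \<in> A}"
  shows "pairing E (relabel h t) = (pairing (pull D g E) t :: 'k::field)"
  using assms
proof (induction t)
  case (Node g' l r)
  have "h ` leaves l = {a \<in> D. g a \<in> leaves l}" "h ` leaves r = {a \<in> D. g a \<in> leaves r}"
    using Node.prems by auto
  moreover have "pairing E (relabel h l) = (pairing (pull D g E) l :: 'k)"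
    "pairing E (relabel h r) = (pairing (pull D g E) r :: 'k)"
    by (rule Node.IH, rule Node.prems, simp add: le_supI1 le_supI2)+
  ultimately show ?case
    by (simp add: optree.set_map arrows_pull)
qed simp

definition block_pull :: "nat \<Rightarrow> (nat \<Rightarrow> nat) \<Rightarrow> (nat \<times> nat) list \<Rightarrow> nat \<Rightarrow> (nat \<times> nat) list" where
  "block_pull m f E i = pull (fiber m f i)
     (the_inv_into {1..card (fiber m f i)} (enumerate_set (fiber m f i))) E"

lemma pairing_block_tree:
  assumes "ts i \<in> tree_monomials (card (fiber m f i))"
  shows "pairing E (block_tree m f ts i) = pairing (block_pull m f E i) (ts i)"
  unfolding block_tree_def block_pull_def
proof (rule pairing_relabel)
  let ?F = "fiber m f i"
  let ?K = "{1..card ?F}" and ?h = "enumerate_set ?F"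
  let ?g = "the_inv_into ?K ?h"
  fix A assume "A \<subseteq> leaves (ts i)"
  then have A: "A \<subseteq> ?K" using assms by (simp add: tree_monomials_def)
  have gh: "?g (?h x) = x" "?h x \<in> ?F" if "x \<in> ?K" for x
    using that the_inv_into_f_f[OF enumerate_set_inj] enumerate_set_image[OF finite_fiber, of m f i]
    by blast+
  have hg: "?h (?g a) = a" if "a \<in> ?F" for a
  proof -
    have "a \<in> ?h ` ?K" using that enumerate_set_image[OF finite_fiber, of m f i] by blast
    then show ?thesis by (rule f_the_inv_into_f[OF enumerate_set_inj])
  qed
  show "?h ` A = {a \<in> ?F. ?g a \<in> A}"
  proof (intro equalityI subsetI)
    fix y assume "y \<in> ?h ` A"
    then obtain x where "x \<in> A" "y = ?h x" by blast
    with gh[of x] A show "y \<in> {a \<in> ?F. ?g a \<in> A}" by auto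
  next
    fix y assume "y \<in> {a \<in> ?F. ?g a \<in> A}"
    then have "y = ?h (?g y)" "?g y \<in> A" using hg by auto
    then show "y \<in> ?h ` A" by (rule image_eqI)
  qed
qed

lemma pairing_tree_comp:
  assumes t: "t \<in> tree_monomials n"
    and ts: "\<forall>i\<in>{1..n}. ts i \<in> tree_monomials (card (fiber m f i))"
  shows "pairing E (tree_comp m f t ts) =
    pairing (pull {1..m} f E) t * (\<Prod>i\<in>{1..n}. pairing (block_pull m f E i) (ts i))"
proof -
  have L: "leaves t = {1..n}" "shuffle_tree t"
    using t by (auto simp: tree_monomials_def)
  have "pairing E (graft t (block_tree m f ts)) =
      pairing (pull {1..m} f E) t * (\<Prod>i\<in>leaves t. pairing E (block_tree m f ts i))"
  proof (rule pairing_graft)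
    fix i assume "i \<in> leaves t"
    then have "leaves (block_tree m f ts i) = fiber m f i"
      unfolding L using ts by (intro leaves_block_tree) blast
    then show "leaves (block_tree m f ts i) = {a \<in> {1..m}. f a = i}"
      unfolding fiber_def .
  qed (rule L(2))
  also have "(\<Prod>i\<in>leaves t. pairing E (block_tree m f ts i)) =
      (\<Prod>i\<in>{1..n}. pairing (block_pull m f E i) (ts i))"
    unfolding L using ts by (intro prod.cong pairing_block_tree) auto
  finally show ?thesis
    by (simp only: tree_comp_eq_graft)
qed

text \<open>Additive extension of a family of additive maps on coefficients; it treats the pairing and
  \<open>permute_rewrite\<close> uniformly.\<close>
definition linear_sum :: "('a \<Rightarrow> 'b \<Rightarrow> 'c) \<Rightarrow> ('a \<Rightarrow>\<^sub>0 'b::ab_group_add) \<Rightarrow> 'c::ab_group_add" where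
  "linear_sum \<phi> x = (\<Sum>t\<in>Poly_Mapping.keys x. \<phi> t (Poly_Mapping.lookup x t))"

context
  fixes \<phi> :: "'a \<Rightarrow> 'b::ab_group_add \<Rightarrow> 'c::ab_group_add"
  assumes additive: "\<And>t a b. \<phi> t (a + b) = \<phi> t a + \<phi> t b"
begin

lemma additive_zero: "\<phi> t 0 = 0"
  using additive[of t 0 0] by simp

lemma linear_sum_superset:
  assumes "finite S" "Poly_Mapping.keys x \<subseteq> S"
  shows "linear_sum \<phi> x = (\<Sum>t\<in>S. \<phi> t (Poly_Mapping.lookup x t))"
  unfolding linear_sum_def
  using assms by (intro sum.mono_neutral_left) (auto simp: in_keys_iff additive_zero)

lemma linear_sum_single: "linear_sum \<phi> (Poly_Mapping.single t c) = \<phi> t c"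
  by (subst linear_sum_superset[of "{t}"]) auto

lemma linear_sum_add: "linear_sum \<phi> (x + y) = linear_sum \<phi> x + linear_sum \<phi> y"
proof -
  let ?S = "Poly_Mapping.keys x \<union> Poly_Mapping.keys y"
  have "linear_sum \<phi> z = (\<Sum>t\<in>?S. \<phi> t (Poly_Mapping.lookup z t))" if "z \<in> {x, y, x + y}" for z
    using that Poly_Mapping.keys_add[of x y] by (intro linear_sum_superset) auto
  then show ?thesis
    by (simp add: lookup_add additive sum.distrib)
qed

lemma linear_sum_zero: "linear_sum \<phi> 0 = 0"
  by (simp add: linear_sum_def)

lemma linear_sum_diff: "linear_sum \<phi> (x - y) = linear_sum \<phi> x - linear_sum \<phi> y"
  using linear_sum_add[of "x - y" y] by (simp add: algebra_simps)

lemma linear_sum_uminus: "linear_sum \<phi> (- x) = - linear_sum \<phi> x"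
  using linear_sum_diff[of 0 x] by (simp add: linear_sum_zero)

lemma linear_sum_sum: "linear_sum \<phi> (\<Sum>i\<in>I. x i) = (\<Sum>i\<in>I. linear_sum \<phi> (x i))"
  by (induction I rule: infinite_finite_induct) (simp_all add: linear_sum_zero linear_sum_add)

end

definition pairing_sum :: "(nat \<times> nat) list \<Rightarrow> 'k::field lincomb \<Rightarrow> 'k" where
  "pairing_sum E = linear_sum (\<lambda>t c. c * pairing E t)"

lemmas pairing_sum_simps =
  linear_sum_single[of "\<lambda>t c. c * pairing E t" for E, folded pairing_sum_def, OF distrib_right]
  linear_sum_add[of "\<lambda>t c. c * pairing E t" for E, folded pairing_sum_def, OF distrib_right]
  linear_sum_zero[of "\<lambda>t c. c * pairing E t" for E, folded pairing_sum_def, OF distrib_right]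
  linear_sum_diff[of "\<lambda>t c. c * pairing E t" for E, folded pairing_sum_def, OF distrib_right]
  linear_sum_uminus[of "\<lambda>t c. c * pairing E t" for E, folded pairing_sum_def, OF distrib_right]
  linear_sum_sum[of "\<lambda>t c. c * pairing E t" for E, folded pairing_sum_def, OF distrib_right]

lemma pairing_sum_eq: "pairing_sum E x =
    (\<Sum>t\<in>Poly_Mapping.keys x. Poly_Mapping.lookup x t * pairing E t)"
  by (simp add: pairing_sum_def linear_sum_def)

lemma pairing_sum_scale:
  "pairing_sum E (Poly_Mapping.map (\<lambda>a. c * a) x) = c * pairing_sum E x"
proof -
  have lookup: "Poly_Mapping.lookup (Poly_Mapping.map (\<lambda>a. c * a) x) t = c * Poly_Mapping.lookup x t" for t
    by (simp add: Poly_Mapping.map.rep_eq when_def)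
  then have "Poly_Mapping.keys (Poly_Mapping.map (\<lambda>a. c * a) x) \<subseteq> Poly_Mapping.keys x"
    by (auto simp: in_keys_iff)
  then have "pairing_sum E (Poly_Mapping.map (\<lambda>a. c * a) x) =
      (\<Sum>t\<in>Poly_Mapping.keys x. c * Poly_Mapping.lookup x t * pairing E t)"
    unfolding pairing_sum_def
    by (subst linear_sum_superset[of _ "Poly_Mapping.keys x"]) (auto simp: distrib_right lookup)
  then show ?thesis
    by (simp add: pairing_sum_eq sum_distrib_left mult.assoc)
qed

text \<open>Multiplicativity on tree monomials, extended multilinearly: the sum over all choices of one
  monomial in each argument factors by the distributive law.\<close>
lemma pairing_sum_shuffle_comp:
  assumes x: "x \<in> operad_component n"
    and ys: "\<forall>i\<in>{1..n}. ys i \<in> operad_component (card (fiber m f i))"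
  shows "pairing_sum E (shuffle_comp m n f x ys) =
    pairing_sum (pull {1..m} f E) x * (\<Prod>i\<in>{1..n}. pairing_sum (block_pull m f E i) (ys i))"
proof -
  let ?P = "\<Pi>\<^sub>E i\<in>{1..n}. Poly_Mapping.keys (ys i)"
  have tree: "pairing E (tree_comp m f t ts) =
      pairing (pull {1..m} f E) t * (\<Prod>i\<in>{1..n}. pairing (block_pull m f E i) (ts i))"
    if "t \<in> Poly_Mapping.keys x" "ts \<in> ?P" for t ts
    using that x ys by (intro pairing_tree_comp) (auto simp: operad_component_def PiE_iff)
  have "pairing_sum E (shuffle_comp m n f x ys) =
      (\<Sum>t\<in>Poly_Mapping.keys x. \<Sum>ts\<in>?P. Poly_Mapping.lookup x t *
        (\<Prod>i\<in>{1..n}. Poly_Mapping.lookup (ys i) (ts i)) * pairing E (tree_comp m f t ts))"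
    by (simp add: shuffle_comp_def pairing_sum_simps)
  also have "\<dots> = (\<Sum>t\<in>Poly_Mapping.keys x. \<Sum>ts\<in>?P.
      (Poly_Mapping.lookup x t * pairing (pull {1..m} f E) t) *
      (\<Prod>i\<in>{1..n}. Poly_Mapping.lookup (ys i) (ts i) * pairing (block_pull m f E i) (ts i)))"
    by (intro sum.cong HOL.refl) (simp add: tree prod.distrib mult_ac)
  also have "\<dots> = pairing_sum (pull {1..m} f E) x *
      (\<Sum>ts\<in>?P. \<Prod>i\<in>{1..n}. Poly_Mapping.lookup (ys i) (ts i) * pairing (block_pull m f E i) (ts i))"
    by (simp add: pairing_sum_eq sum_product)
  also have "(\<Sum>ts\<in>?P. \<Prod>i\<in>{1..n}. Poly_Mapping.lookup (ys i) (ts i) * pairing (block_pull m f E i) (ts i)) =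
      (\<Prod>i\<in>{1..n}. pairing_sum (block_pull m f E i) (ys i))"
    unfolding pairing_sum_eq by (rule prod_sum_PiE[symmetric]) auto
  finally show ?thesis .
qed

lemma shuffle_comp_in_operad_component:
  assumes f: "shuffle_surj m n f" and x: "x \<in> operad_component n"
    and ys: "\<forall>i\<in>{1..n}. ys i \<in> operad_component (card (fiber m f i))"
  shows "shuffle_comp m n f x ys \<in> operad_component m"
proof -
  have "tree_comp m f t ts \<in> tree_monomials m"
    if "t \<in> Poly_Mapping.keys x" "ts \<in> (\<Pi>\<^sub>E i\<in>{1..n}. Poly_Mapping.keys (ys i))" for t ts
    using that x ys f by (intro tree_comp_in_tree_monomials) (auto simp: operad_component_def PiE_iff)
  then show ?thesis
    unfolding shuffle_comp_def operad_component_def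
    by (auto dest!: subsetD[OF keys_sum] split: if_splits)
qed

lemma leaves_shuffle_form [simp]: "leaves (shuffle_form t) = leaves t"
  by (induction t) auto

text \<open>Exchanging the subtrees at a vertex reverses the roles of the edges across it, which changes the
  weight by the same sign as in \<open>shuffle_sign\<close>.\<close>
lemma pairing_shuffle_form: "shuffle_sign t * pairing E (shuffle_form t) = (pairing E t :: 'k::field)"
proof (induction t)
  case (Node g l r)
  let ?w = "vertex_weight g :: nat \<Rightarrow> nat \<Rightarrow> 'k"
  let ?l = "leaves l" and ?r = "leaves r"
  show ?case
  proof (cases "Min ?l < Min ?r")
    case True
    then have "shuffle_sign (Node g l r) * pairing E (shuffle_form (Node g l r)) =
        ?w (arrows E ?l ?r) (arrows E ?r ?l) *
        (shuffle_sign l * pairing E (shuffle_form l)) * (shuffle_sign r * pairing E (shuffle_form r))"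
      by (simp del: Min_gr_iff)
    then show ?thesis by (simp add: Node)
  next
    case False
    then have "shuffle_sign (Node g l r) * pairing E (shuffle_form (Node g l r)) =
        (if g = Mu then 1 else -1) * ?w (arrows E ?r ?l) (arrows E ?l ?r) *
        (shuffle_sign l * pairing E (shuffle_form l)) * (shuffle_sign r * pairing E (shuffle_form r))"
      by (simp del: Min_gr_iff)
    also have "(if g = Mu then 1 else -1) * ?w (arrows E ?r ?l) (arrows E ?l ?r) =
        ?w (arrows E ?l ?r) (arrows E ?r ?l)"
      by (cases g) simp_all
    finally show ?thesis by (simp add: Node)
  qed
qed simp

lemma pairing_sum_permute_rewrite:
  "pairing_sum E (permute_rewrite \<sigma> x) = linear_sum (\<lambda>t c. c * pairing E (relabel \<sigma> t)) x"
proof -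
  have "pairing_sum E (permute_rewrite \<sigma> x) = (\<Sum>t\<in>Poly_Mapping.keys x.
      Poly_Mapping.lookup x t *
      (shuffle_sign (relabel \<sigma> t) * pairing E (shuffle_form (relabel \<sigma> t))))"
    by (simp add: permute_rewrite_def pairing_sum_simps mult_ac)
  then show ?thesis
    by (simp only: pairing_shuffle_form linear_sum_def)
qed

lemma arrows_doubleton:
  assumes "p \<noteq> q"
  shows "arrows E {p, q} C = arrows E {p} C + arrows E {q} C"
    and "arrows E C {p, q} = arrows E C {p} + arrows E C {q}"
proof -
  have "{p, q} = {p} \<union> {q}" "{p} \<inter> {q} = {}"
    using assms by auto
  then show "arrows E {p, q} C = arrows E {p} C + arrows E {q} C"
    "arrows E C {p, q} = arrows E C {p} + arrows E C {q}"
    using arrows_Un_left[of "{p}" "{q}"] arrows_Un_right[of "{p}" "{q}"] by metis+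
qed

text \<open>In the next three lemmas three blocks \<open>p\<close>, \<open>q\<close>, \<open>r\<close> are given by the numbers of edges between them:
  \<open>pq\<close> counts the edges from \<open>p\<close> to \<open>q\<close>. A term is nonzero only if the total number of edges equals the
  number of brackets, which leaves finitely many configurations to compare.\<close>
lemma vertex_weight_associative:
  "vertex_weight Mu (pr + qr) (rp + rq) * vertex_weight Mu pq qp =
    (vertex_weight Mu (pq + pr) (qp + rp) * vertex_weight Mu qr rq :: 'k::field)"
  by simp

lemma vertex_weight_Leibniz:
  "vertex_weight Lam (pq + pr) (qp + rp) * vertex_weight Mu qr rq =
    (vertex_weight Mu (pr + qr) (rp + rq) * vertex_weight Lam pq qp +
     vertex_weight Mu (pq + rq) (qp + qr) * vertex_weight Lam pr rp :: 'k::field)"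
  by (simp add: add_is_1)

lemma vertex_weight_Jacobi:
  "vertex_weight Lam (pq + pr) (qp + rp) * vertex_weight Lam qr rq =
    (vertex_weight Lam (pr + qr) (rp + rq) * vertex_weight Lam pq qp -
     vertex_weight Lam (pq + rq) (qp + qr) * vertex_weight Lam pr rp :: 'k::field)"
  by (simp add: add_is_1)

lemma pairing_identities:
  assumes "p \<noteq> q" "p \<noteq> r" "q \<noteq> r"
  shows "pairing E (mu (mu (Leaf p) (Leaf q)) (Leaf r)) =
      (pairing E (mu (Leaf p) (mu (Leaf q) (Leaf r))) :: 'k::field)"
    and "pairing E (lam (Leaf p) (mu (Leaf q) (Leaf r))) =
      (pairing E (mu (lam (Leaf p) (Leaf q)) (Leaf r)) +
       pairing E (mu (lam (Leaf p) (Leaf r)) (Leaf q)) :: 'k)"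
    and "pairing E (lam (Leaf p) (lam (Leaf q) (Leaf r))) =
      (pairing E (lam (lam (Leaf p) (Leaf q)) (Leaf r)) -
       pairing E (lam (lam (Leaf p) (Leaf r)) (Leaf q)) :: 'k)"
proof -
  note doubleton = arrows_doubleton[OF assms(1)] arrows_doubleton[OF assms(2)] arrows_doubleton[OF assms(3)]
  note expand = pairing.simps optree.set Un_insert_left Un_empty_left
    doubleton mult_1_left mult_1_right
  show "pairing E (mu (mu (Leaf p) (Leaf q)) (Leaf r)) =
      (pairing E (mu (Leaf p) (mu (Leaf q) (Leaf r))) :: 'k::field)"
    unfolding expand by (rule vertex_weight_associative)
  show "pairing E (lam (Leaf p) (mu (Leaf q) (Leaf r))) =
      (pairing E (mu (lam (Leaf p) (Leaf q)) (Leaf r)) +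
       pairing E (mu (lam (Leaf p) (Leaf r)) (Leaf q)) :: 'k)"
    unfolding expand by (rule vertex_weight_Leibniz)
  show "pairing E (lam (Leaf p) (lam (Leaf q) (Leaf r))) =
      (pairing E (lam (lam (Leaf p) (Leaf q)) (Leaf r)) -
       pairing E (lam (lam (Leaf p) (Leaf r)) (Leaf q)) :: 'k)"
    unfolding expand by (rule vertex_weight_Jacobi)
qed

lemma pairing_sum_relation:
  assumes "x \<in> poisson_relations n"
  shows "pairing_sum E x = 0"
proof -
  obtain \<sigma> y where x: "x = permute_rewrite \<sigma> y" and \<sigma>: "\<sigma> permutes {1..3}"
    and y: "y \<in> poisson_identities"
    using assms by (auto simp: poisson_relations_def split: if_splits)
  have "\<sigma> 1 \<noteq> \<sigma> 2" "\<sigma> 1 \<noteq> \<sigma> 3" "\<sigma> 2 \<noteq> \<sigma> 3"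
    using permutes_inj[OF \<sigma>] by (simp_all add: inj_eq)
  note identities = pairing_identities[OF this]
  show ?thesis
    using y unfolding x pairing_sum_permute_rewrite poisson_identities_def
    by (elim insertE emptyE; simp only:
        linear_sum_diff linear_sum_add linear_sum_single distrib_right
        optree.map identities mult_1_left) simp_all
qed

section \<open>Normal trees and their graphs\<close>

primrec mu_free :: "'a optree \<Rightarrow> bool" where
  "mu_free (Leaf a) \<longleftrightarrow> True"
| "mu_free (Node g l r) \<longleftrightarrow> g = Lam \<and> mu_free l \<and> mu_free r"

text \<open>These turn out to be the tree monomials that no leading monomial of a relation divides. The last
  condition says that the brackets with a common least leaf appear from the root downwards in the
  order of the least leaves of their right arguments.\<close>
primrec normal_tree :: "nat optree \<Rightarrow> bool" where
  "normal_tree (Leaf a) \<longleftrightarrow> True"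
| "normal_tree (Node g l r) \<longleftrightarrow> normal_tree l \<and> normal_tree r \<and> mu_free l \<and>
     (g = Lam \<longrightarrow> mu_free r \<and> (\<forall>v\<in>leaves l. v \<noteq> Min (leaves l) \<longrightarrow> Min (leaves r) < v))"

text \<open>For a bracket tree this is an increasing spanning tree on the leaf labels; in general its
  components are the leaf sets of the maximal bracket subtrees.\<close>
primrec edges :: "nat optree \<Rightarrow> (nat \<times> nat) list" where
  "edges (Leaf a) = []"
| "edges (Node g l r) =
     (if g = Lam then [(Min (leaves l), Min (leaves r))] else []) @ edges l @ edges r"

lemma edges_in_leaves: "(a, b) \<in> set (edges t) \<Longrightarrow> a \<in> leaves t \<and> b \<in> leaves t"
  by (induction t) (auto split: if_splits)

lemma arrows_append: "arrows (E @ E') A B = arrows E A B + arrows E' A B"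
  by (simp add: arrows_def)

lemma arrows_eq_0_iff: "arrows E A B = 0 \<longleftrightarrow> (\<forall>(a, b)\<in>set E. \<not> (a \<in> A \<and> b \<in> B))"
  by (auto simp: arrows_def filter_empty_conv)

lemma pairing_edges_self: "shuffle_tree t \<Longrightarrow> pairing (edges t) t = (1 :: 'k::field)"
proof (induction t)
  case (Node g l r)
  let ?E = "edges (Node g l r)"
  have disj: "leaves l \<inter> leaves r = {}" using Node.prems by simp
  have zero: "arrows (edges l) (leaves l) (leaves r) = 0" "arrows (edges l) (leaves r) (leaves l) = 0"
    "arrows (edges r) (leaves l) (leaves r) = 0" "arrows (edges r) (leaves r) (leaves l) = 0"
    using disj edges_in_leaves by (auto simp: arrows_eq_0_iff)
  have Min: "Min (leaves l) \<in> leaves l" "Min (leaves r) \<in> leaves r"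
    by (intro Min_in finite_leaves leaves_nonempty)+
  have not_in: "Min (leaves l) \<notin> leaves r" "Min (leaves r) \<notin> leaves l"
    using disj Min by blast+
  then have "vertex_weight g (arrows ?E (leaves l) (leaves r)) (arrows ?E (leaves r) (leaves l)) = (1 :: 'k)"
    using Min zero by (cases g) (simp_all add: arrows_append, simp_all add: arrows_def)
  moreover have "pairing ?E l = (pairing (edges l) l :: 'k)" "pairing ?E r = (pairing (edges r) r :: 'k)"
  proof -
    have "filter (\<lambda>(a, b). a \<in> leaves q \<and> b \<in> leaves q) (edges q') = []"
      if "leaves q \<inter> leaves q' = {}" for q q'
      using that edges_in_leaves[of _ _ q'] by (auto simp: filter_empty_conv)
    moreover have "leaves r \<inter> leaves l = {}" using disj by auto
    ultimately show "pairing ?E l = (pairing (edges l) l :: 'k)" "pairing ?E r = (pairing (edges r) r :: 'k)"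
      using disj not_in by (auto intro!: pairing_cong)
  qed
  ultimately show ?case
    using Node by simp
qed simp

text \<open>The leaves below the last common vertex of \<open>a\<close> and \<open>b\<close>.\<close>
primrec cluster :: "nat optree \<Rightarrow> nat \<Rightarrow> nat \<Rightarrow> nat set" where
  "cluster (Leaf c) a b = {c}"
| "cluster (Node g l r) a b =
     (if a \<in> leaves l \<and> b \<in> leaves l then cluster l a b
      else if a \<in> leaves r \<and> b \<in> leaves r then cluster r a b
      else leaves l \<union> leaves r)"

lemma cluster_subset: "cluster t a b \<subseteq> leaves t"
  by (induction t) auto

lemma endpoints_in_cluster:
  "a \<in> leaves t \<Longrightarrow> b \<in> leaves t \<Longrightarrow> a \<in> cluster t a b \<and> b \<in> cluster t a b"
  by (induction t) auto

lemma cluster_Node_cases: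
  assumes "shuffle_tree (Node g l r)"
  obtains (left) "a \<in> leaves l" "b \<in> leaves l" "cluster (Node g l r) a b = cluster l a b"
    | (right) "a \<in> leaves r" "b \<in> leaves r" "cluster (Node g l r) a b = cluster r a b"
    | (crossing) "\<not> (a \<in> leaves l \<and> b \<in> leaves l)" "\<not> (a \<in> leaves r \<and> b \<in> leaves r)"
        "cluster (Node g l r) a b = leaves l \<union> leaves r"
proof -
  have "leaves l \<inter> leaves r = {}" using assms by simp
  then show ?thesis
    using left right crossing
    by (cases "a \<in> leaves l \<and> b \<in> leaves l"; cases "a \<in> leaves r \<and> b \<in> leaves r")
      (auto simp: disjoint_iff)
qed

lemma cluster_laminar:
  assumes "shuffle_tree t" "x \<in> cluster t a b" "x \<in> cluster t c d"
  shows "cluster t a b \<subseteq> cluster t c d \<or> cluster t c d \<subseteq> cluster t a b"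
  using assms
proof (induction t)
  case (Node g l r)
  have disj: "leaves l \<inter> leaves r = {}" and sub: "shuffle_tree l" "shuffle_tree r"
    using Node.prems(1) by auto
  have all: "cluster (Node g l r) u v \<subseteq> leaves l \<union> leaves r" for u v
    using cluster_subset[of "Node g l r" u v] by simp
  have no_common: False if "x \<in> cluster l u v" "x \<in> cluster r u' v'" for u v u' v'
    using that cluster_subset[of l u v] cluster_subset[of r u' v'] disj by blast
  show ?case
  proof (cases rule: cluster_Node_cases[OF Node.prems(1), of a b, case_names left right crossing])
    case ab: left
    show ?thesis
      by (cases rule: cluster_Node_cases[OF Node.prems(1), of c d])
        (use Node.IH(1)[OF sub(1)] Node.prems(2,3) ab(3) all no_common in metis)+
  next
    case ab: right
    show ?thesis
      by (cases rule: cluster_Node_cases[OF Node.prems(1), of c d])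
        (use Node.IH(2)[OF sub(2)] Node.prems(2,3) ab(3) all no_common in metis)+
  next
    case crossing
    then show ?thesis using all by metis
  qed
qed simp

lemma length_filter_partition:
  assumes "\<And>x. P x \<longleftrightarrow> Q x \<or> R x" "\<And>x. \<not> (Q x \<and> R x)"
  shows "length (filter P xs) = length (filter Q xs) + length (filter R xs)"
  using assms by (induction xs) auto

lemma vertex_weight_nonzero:
  "vertex_weight g x y \<noteq> (0 :: 'k::field) \<longleftrightarrow> x + y = of_bool (g = Lam)"
  by (cases g) auto

lemma pairing_Node_nonzero:
  assumes "pairing E (Node g l r) \<noteq> (0 :: 'k::field)"
  shows "arrows E (leaves l) (leaves r) + arrows E (leaves r) (leaves l) = of_bool (g = Lam)"
    and "pairing E l \<noteq> (0 :: 'k)" and "pairing E r \<noteq> (0 :: 'k)"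
  using assms vertex_weight_nonzero[of g, where 'k = 'k] by auto

text \<open>A nonzero pairing makes edges and brackets correspond, so the brackets above \<open>v\<close> may be counted
  as edges. Loops are excluded because a loop at \<open>v\<close> would have the cluster \<open>{v}\<close> but no bracket.\<close>
lemma count_Lam_eq_clusters:
  assumes "pairing E s \<noteq> (0 :: 'k::field)" "shuffle_tree s" "v \<in> leaves s"
    and "\<forall>(a, b)\<in>set E. a \<noteq> b"
  shows "count_above Lam s v v =
    length (filter (\<lambda>(a, b). a \<in> leaves s \<and> b \<in> leaves s \<and> v \<in> cluster s a b) E)"
  using assms
proof (induction s)
  case (Leaf c)
  then have "filter (\<lambda>(a, b). a = c \<and> b = c) E = []"
    by (auto simp: filter_empty_conv)
  then show ?case
    using Leaf by (simp add: conj_commute cong: conj_cong)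
next
  case (Node g l r)
  have disj: "leaves l \<inter> leaves r = {}" and sub: "shuffle_tree l" "shuffle_tree r"
    using Node.prems(2) by auto
  let ?all = "\<lambda>(a, b). a \<in> leaves (Node g l r) \<and> b \<in> leaves (Node g l r) \<and> v \<in> cluster (Node g l r) a b"
  let ?lr = "\<lambda>(a, b). a \<in> leaves l \<and> b \<in> leaves r" and ?rl = "\<lambda>(a, b). a \<in> leaves r \<and> b \<in> leaves l"
  let ?in = "\<lambda>q (a, b). a \<in> leaves q \<and> b \<in> leaves q \<and> v \<in> cluster q a b"
  have all: "?all e \<longleftrightarrow> (?lr e \<or> ?rl e) \<or> (?in l e \<or> ?in r e)" for e
  proof -
    obtain a b where e: "e = (a, b)" by (cases e)
    show ?thesis
      using Node.prems(2,3) disj unfolding e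
      by (cases rule: cluster_Node_cases[OF Node.prems(2), of a b]) (auto simp del: cluster.simps)
  qed
  have "length (filter ?all E) =
      length (filter (\<lambda>e. ?lr e \<or> ?rl e) E) + length (filter (\<lambda>e. ?in l e \<or> ?in r e) E)"
    using disj by (intro length_filter_partition all) auto
  also have "length (filter (\<lambda>e. ?lr e \<or> ?rl e) E) = length (filter ?lr E) + length (filter ?rl E)"
    using disj by (intro length_filter_partition HOL.refl) auto
  also have "\<dots> = of_bool (g = Lam)"
    using pairing_Node_nonzero(1)[OF Node.prems(1)] by (simp add: arrows_def)
  also have "length (filter (\<lambda>e. ?in l e \<or> ?in r e) E) = length (filter (?in l) E) + length (filter (?in r) E)"
    using disj by (intro length_filter_partition HOL.refl) auto
  finally have total: "length (filter ?all E) =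
      of_bool (g = Lam) + (length (filter (?in l) E) + length (filter (?in r) E))" .
  have none: "filter (?in q) E = []" if "v \<notin> leaves q" for q
    using that cluster_subset[of q] by (fastforce simp: filter_empty_conv)
  have "v \<in> leaves l \<and> v \<notin> leaves r \<or> v \<in> leaves r \<and> v \<notin> leaves l"
    using Node.prems(3) disj by auto
  then show ?case
  proof (elim disjE conjE)
    assume v: "v \<in> leaves l" "v \<notin> leaves r"
    then have "count_above Lam l v v = length (filter (?in l) E)"
      using pairing_Node_nonzero(2)[OF Node.prems(1)] Node.prems(4) sub by (intro Node.IH)
    then show ?thesis unfolding total using v none[OF v(2)] by (auto simp: eq_commute)
  next
    assume v: "v \<in> leaves r" "v \<notin> leaves l"
    then have "count_above Lam r v v = length (filter (?in r) E)"
      using pairing_Node_nonzero(3)[OF Node.prems(1)] Node.prems(4) sub by (intro Node.IH)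
    then show ?thesis unfolding total using v none[OF v(2)] by (auto simp: eq_commute)
  qed
qed

lemma edges_increasing: "shuffle_tree t \<Longrightarrow> (a, b) \<in> set (edges t) \<Longrightarrow> a < b"
  by (induction t) (auto simp del: Min_gr_iff split: if_splits)

text \<open>In a bracket tree every leaf but the least one is the least leaf of some right subtree.\<close>
lemma mu_free_parent:
  assumes "mu_free t" "shuffle_tree t" "v \<in> leaves t" "v \<noteq> Min (leaves t)"
  shows "\<exists>p. (p, v) \<in> set (edges t)"
  using assms
proof (induction t)
  case (Node g l r)
  have "Min (leaves l \<union> leaves r) = Min (leaves l)"
    using Node.prems(2) by (simp add: Min_Un del: Min_gr_iff)
  then have "v \<noteq> Min (leaves l)" using Node.prems(4) by simp
  consider "v \<in> leaves l" | "v \<in> leaves r" "v \<noteq> Min (leaves r)" | "v = Min (leaves r)"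
    using Node.prems(3) by auto
  then show ?case
  proof cases
    case 1
    then have "\<exists>p. (p, v) \<in> set (edges l)"
      using Node.prems \<open>v \<noteq> Min (leaves l)\<close> by (intro Node.IH) auto
    then show ?thesis by auto
  next
    case 2
    then have "\<exists>p. (p, v) \<in> set (edges r)"
      using Node.prems by (intro Node.IH) auto
    then show ?thesis by auto
  qed (use Node.prems in auto)
qed simp

text \<open>Let the bracket of the edge \<open>(q, c)\<close> lie above \<open>v\<close>. Then the edge that attaches \<open>v\<close> to its parent
  \<open>p\<close> belongs to a lower bracket, on one of the two sides, and the end \<open>w\<close> of \<open>(q, c)\<close> on the other
  side is outside its cluster. If \<open>v\<close> is on the right, \<open>w = q\<close> is smaller than \<open>v\<close>; if it is on the
  left, \<open>w = c\<close> is smaller than \<open>v\<close> by the ordering condition on normal trees.\<close>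
lemma normal_tree_parent:
  assumes "normal_tree t" "shuffle_tree t" "(q, c) \<in> set (edges t)"
    and "v \<in> cluster t q c" "v \<noteq> q" "v \<noteq> c"
  shows "\<exists>p. (p, v) \<in> set (edges t) \<and> p \<in> cluster t q c \<and>
    (\<exists>w\<in>{q, c}. w < v \<and> w \<notin> cluster t p v)"
  using assms
proof (induction t)
  case (Node g l r)
  have disj: "leaves l \<inter> leaves r = {}" and sub: "shuffle_tree l" "shuffle_tree r"
    and lt: "Min (leaves l) < Min (leaves r)"
    using Node.prems(2) by auto
  have Min: "Min (leaves l) \<in> leaves l" "Min (leaves r) \<in> leaves r"
    by (intro Min_in finite_leaves leaves_nonempty)+
  have cl: "cluster (Node g l r) x y = cluster l x y" if "x \<in> leaves l" "y \<in> leaves l" for x y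
    using that by simp
  have cr: "cluster (Node g l r) x y = cluster r x y" if "x \<in> leaves r" "y \<in> leaves r" for x y
    using that disj by auto
  consider (root) "g = Lam" "q = Min (leaves l)" "c = Min (leaves r)"
    | (left) "(q, c) \<in> set (edges l)" | (right) "(q, c) \<in> set (edges r)"
    using Node.prems(3) by (auto split: if_splits)
  then show ?case
  proof cases
    case root
    have "q \<notin> leaves r" "c \<notin> leaves l"
      using root Min disj by blast+
    then have cluster_eq: "cluster (Node g l r) q c = leaves l \<union> leaves r"
      by simp
    consider "v \<in> leaves l" | "v \<in> leaves r"
      using Node.prems(4) unfolding cluster_eq by auto
    then show ?thesis
    proof cases
      case 1
      then obtain p where p: "(p, v) \<in> set (edges l)"
        using mu_free_parent[of l v] Node.prems sub root by auto
      then have "p \<in> leaves l" using edges_in_leaves by blast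
      moreover have "c \<notin> cluster l p v" using cluster_subset[of l p v] root Min disj by blast
      moreover have "c < v" using Node.prems(1,5) 1 root by simp
      ultimately show ?thesis
        using p 1 by (intro exI[of _ p]) (simp add: cluster_eq cl del: cluster.simps)
    next
      case 2
      then obtain p where p: "(p, v) \<in> set (edges r)"
        using mu_free_parent[of r v] Node.prems sub root by auto
      then have "p \<in> leaves r" using edges_in_leaves by blast
      moreover have "q \<notin> cluster r p v" using cluster_subset[of r p v] root Min disj by blast
      moreover have "q < v" using lt 2 root by (meson Min_le finite_leaves less_le_trans)
      ultimately show ?thesis
        using p 2 by (intro exI[of _ p]) (simp add: cluster_eq cr del: cluster.simps)
    qed
  next
    case left
    then have qc: "q \<in> leaves l" "c \<in> leaves l" using edges_in_leaves by blast+
    obtain p w where p: "(p, v) \<in> set (edges l)" "p \<in> cluster l q c" "w \<in> {q, c}" "w < v" "w \<notin> cluster l p v"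
      using Node.IH(1)[OF _ sub(1) left] Node.prems(1,4,5,6) cl[OF qc] by auto
    moreover have "p \<in> leaves l" "v \<in> leaves l" using p(1) edges_in_leaves by blast+
    ultimately show ?thesis
      using cl qc by (intro exI[of _ p] conjI bexI[of _ w]) (simp_all del: cluster.simps)
  next
    case right
    then have qc: "q \<in> leaves r" "c \<in> leaves r" using edges_in_leaves by blast+
    obtain p w where p: "(p, v) \<in> set (edges r)" "p \<in> cluster r q c" "w \<in> {q, c}" "w < v" "w \<notin> cluster r p v"
      using Node.IH(2)[OF _ sub(2) right] Node.prems(1,4,5,6) cr[OF qc] by auto
    moreover have "p \<in> leaves r" "v \<in> leaves r" using p(1) edges_in_leaves by blast+
    ultimately show ?thesis
      using cr qc by (intro exI[of _ p] conjI bexI[of _ w]) (simp_all del: cluster.simps)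
  qed
qed simp

lemma filter_eq_if_length_eq:
  assumes "length (filter P xs) = length (filter Q xs)" "\<And>x. x \<in> set xs \<Longrightarrow> P x \<Longrightarrow> Q x" "x \<in> set xs" "Q x"
  shows "P x"
proof -
  have le: "length (filter P ys) \<le> length (filter Q ys)" if "\<And>x. x \<in> set ys \<Longrightarrow> P x \<Longrightarrow> Q x" for ys
    using that by (induction ys) (auto simp: le_Suc_eq)
  show ?thesis
    using assms
  proof (induction xs)
    case (Cons y ys)
    have "length (filter P ys) \<le> length (filter Q ys)" using Cons.prems(2) by (intro le) auto
    moreover have "P y \<Longrightarrow> Q y" using Cons.prems(2) by simp
    ultimately show ?case
      using Cons by (auto split: if_splits)
  qed simp
qed

lemma length_filter_mono:
  "(\<And>x. x \<in> set xs \<Longrightarrow> P x \<Longrightarrow> Q x) \<Longrightarrow> length (filter P xs) \<le> length (filter Q xs)"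
  by (induction xs) (auto simp: le_Suc_eq)

text \<open>The situation of the triangularity claim: \<open>s\<close> is any tree that pairs nontrivially with the graph of
  the normal tree \<open>t\<close>, so the brackets of both trees are indexed by the edges of this graph.\<close>
context
  fixes s t :: "nat optree"
  assumes normal: "normal_tree t" and t: "shuffle_tree t" and s: "shuffle_tree s"
    and leaves: "leaves s = leaves t" and nonzero: "pairing (edges t) s \<noteq> (0 :: 'k::field)"
begin

lemma count_Lam_edges:
  assumes "u \<in> {s, t}" "v \<in> leaves t"
  shows "count_above Lam u v v = length (filter (\<lambda>(a, b). v \<in> cluster u a b) (edges t))"
proof -
  have "\<forall>(a, b)\<in>set (edges t). a \<noteq> b"
    using edges_increasing[OF t] by fastforce
  moreover have "pairing (edges t) u \<noteq> (0 :: 'k)" "shuffle_tree u" "leaves u = leaves t"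
    using assms(1) nonzero pairing_edges_self[OF t, where 'k = 'k] s t leaves by auto
  ultimately have "count_above Lam u v v =
      length (filter (\<lambda>(a, b). a \<in> leaves t \<and> b \<in> leaves t \<and> v \<in> cluster u a b) (edges t))"
    using count_Lam_eq_clusters[of "edges t" u v, where 'k = 'k] assms(2) by simp
  also have "filter (\<lambda>(a, b). a \<in> leaves t \<and> b \<in> leaves t \<and> v \<in> cluster u a b) (edges t) =
      filter (\<lambda>(a, b). v \<in> cluster u a b) (edges t)"
    using edges_in_leaves by (intro filter_cong) auto
  finally show ?thesis .
qed

text \<open>Where the counts agree on a smaller leaf \<open>u\<close>, the inclusion for \<open>u\<close> is an equality, so \<open>u\<close> lies in
  the same clusters of \<open>s\<close> and \<open>t\<close>. For \<open>v\<close>, take \<open>p\<close> and \<open>w\<close> from \<open>normal_tree_parent\<close>. In \<open>s\<close> the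
  clusters of \<open>(q, c)\<close> and \<open>(p, v)\<close> share \<open>p\<close>, so they are nested. The first cannot be inside the
  second, which does not contain \<open>w\<close>; so the first contains the second, and with it \<open>v\<close>.\<close>
lemma cluster_mono:
  assumes "v \<in> leaves t" "\<And>u. u \<in> leaves t \<Longrightarrow> u < v \<Longrightarrow> count_above Lam s u u = count_above Lam t u u"
    and "(q, c) \<in> set (edges t)" "v \<in> cluster t q c"
  shows "v \<in> cluster s q c"
  using assms
proof (induction v arbitrary: q c rule: less_induct)
  case (less v)
  have eq: "u \<in> cluster s a b \<longleftrightarrow> u \<in> cluster t a b"
    if "u \<in> leaves t" "u < v" "(a, b) \<in> set (edges t)" for u a b
  proof -
    have mono: "u \<in> cluster s a b" if "(a, b) \<in> set (edges t)" "u \<in> cluster t a b" for a b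
      using less.IH[OF \<open>u < v\<close> \<open>u \<in> leaves t\<close> _ that] less.prems(2) \<open>u < v\<close> by force
    moreover have "u \<in> cluster t a b" if "u \<in> cluster s a b"
      using filter_eq_if_length_eq[of "\<lambda>(a, b). u \<in> cluster t a b" "edges t" "\<lambda>(a, b). u \<in> cluster s a b" "(a, b)"]
        that mono \<open>(a, b) \<in> set (edges t)\<close> less.prems(2)[OF \<open>u \<in> leaves t\<close> \<open>u < v\<close>]
        count_Lam_edges[OF _ \<open>u \<in> leaves t\<close>] by auto
    ultimately show ?thesis using \<open>(a, b) \<in> set (edges t)\<close> by blast
  qed
  have qc: "q \<in> leaves s" "c \<in> leaves s"
    using edges_in_leaves[OF less.prems(3)] leaves by auto
  show ?case
  proof (cases "v = q \<or> v = c")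
    case True
    then show ?thesis using endpoints_in_cluster[OF qc] by auto
  next
    case False
    then obtain p w where p: "(p, v) \<in> set (edges t)" "p \<in> cluster t q c"
      and w: "w \<in> {q, c}" "w < v" "w \<notin> cluster t p v"
      using normal_tree_parent[OF normal t less.prems(3,4)] by blast
    have pv: "p \<in> leaves s" "v \<in> leaves s" "p < v"
      using edges_in_leaves[OF p(1)] edges_increasing[OF t p(1)] leaves by auto
    have "p \<in> cluster s q c" "p \<in> cluster s p v" "v \<in> cluster s p v" "w \<in> cluster s q c"
      using eq[OF _ pv(3) less.prems(3)] p(2) pv leaves w(1) endpoints_in_cluster[OF pv(1,2)]
        endpoints_in_cluster[OF qc] by auto
    moreover have "w \<notin> cluster s p v"
      using eq[OF _ w(2) p(1)] w qc leaves by auto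
    ultimately show ?thesis
      using cluster_laminar[OF s] by blast
  qed
qed

lemma count_Lam_le:
  assumes "v \<in> leaves t" "\<And>u. u \<in> leaves t \<Longrightarrow> u < v \<Longrightarrow> count_above Lam s u u = count_above Lam t u u"
  shows "count_above Lam t v v \<le> count_above Lam s v v"
  using cluster_mono[OF assms] count_Lam_edges[OF _ assms(1)]
  by (auto intro!: length_filter_mono)

lemma clusters_eq:
  assumes "\<And>u. u \<in> leaves t \<Longrightarrow> count_above Lam s u u = count_above Lam t u u"
    and "(a, b) \<in> set (edges t)"
  shows "cluster s a b = cluster t a b"
proof -
  have "u \<in> cluster s a b \<longleftrightarrow> u \<in> cluster t a b" if u: "u \<in> leaves t" for u
  proof
    show "u \<in> cluster t a b \<Longrightarrow> u \<in> cluster s a b"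
      using cluster_mono[OF u] assms by blast
    assume "u \<in> cluster s a b"
    then show "u \<in> cluster t a b"
      using filter_eq_if_length_eq[of "\<lambda>(a, b). u \<in> cluster t a b" "edges t" "\<lambda>(a, b). u \<in> cluster s a b" "(a, b)"]
        cluster_mono[OF u] assms count_Lam_edges[of s, OF _ u] count_Lam_edges[of t, OF _ u] u by auto
  qed
  then show ?thesis
    using cluster_subset[of s a b] cluster_subset[of t a b] leaves by blast
qed

end

section \<open>Triangularity of the pairing\<close>

text \<open>At the first element of \<open>A\<close> where the functions differ, \<open>y\<close> is greater.\<close>
definition first_rise :: "nat set \<Rightarrow> (nat \<Rightarrow> nat) \<Rightarrow> (nat \<Rightarrow> nat) \<Rightarrow> bool" where
  "first_rise A x y \<longleftrightarrow> (\<exists>v\<in>A. x v < y v \<and> (\<forall>u\<in>A. u < v \<longrightarrow> x u = y u))"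

lemma first_rise_Un:
  assumes "first_rise A x y" "first_rise B x y \<or> (\<forall>v\<in>B. x v = y v)"
  shows "first_rise (A \<union> B) x y"
proof -
  obtain v where v: "v \<in> A" "x v < y v" "\<And>u. u \<in> A \<Longrightarrow> u < v \<Longrightarrow> x u = y u"
    using assms(1) unfolding first_rise_def by blast
  show ?thesis
  proof (cases "\<forall>u\<in>B. u < v \<longrightarrow> x u = y u")
    case True
    then show ?thesis
      using v unfolding first_rise_def by blast
  next
    case False
    then obtain w where w: "w \<in> B" "x w < y w" "\<And>u. u \<in> B \<Longrightarrow> u < w \<Longrightarrow> x u = y u"
      using assms(2) unfolding first_rise_def by blast
    then have "w < v"
      using False by (metis linorder_neqE_nat order_less_trans)
    then show ?thesis
      using v w unfolding first_rise_def by (meson UnCI UnE order_less_trans)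
  qed
qed

lemma first_rise_shift:
  assumes "\<And>v. v \<in> A \<Longrightarrow> x v = c + x' v" "\<And>v. v \<in> A \<Longrightarrow> y v = c + y' v"
  shows "first_rise A x y \<longleftrightarrow> first_rise A x' y'"
  unfolding first_rise_def using assms by auto

lemma count_Mu_mu_free: "mu_free t \<Longrightarrow> count_above Mu t v w = 0"
  by (induction t) auto

text \<open>With a nonzero pairing, the leaf set of a subtree whose root is a bracket is the cluster of an edge.\<close>
lemma Lam_crossing_edge:
  assumes "pairing E (Node Lam l r) \<noteq> (0 :: 'k::field)" "shuffle_tree (Node Lam l r)"
  obtains a b where "(a, b) \<in> set E" "a \<in> leaves l \<union> leaves r" "b \<in> leaves l \<union> leaves r"
    "cluster (Node Lam l r) a b = leaves l \<union> leaves r"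
proof -
  have disj: "leaves l \<inter> leaves r = {}" using assms(2) by simp
  have "arrows E (leaves l) (leaves r) \<noteq> 0 \<or> arrows E (leaves r) (leaves l) \<noteq> 0"
    using pairing_Node_nonzero(1)[OF assms(1)] by auto
  then obtain a b where "(a, b) \<in> set E"
    "a \<in> leaves l \<and> b \<in> leaves r \<or> a \<in> leaves r \<and> b \<in> leaves l"
    unfolding arrows_eq_0_iff by blast
  moreover from this have "\<not> (a \<in> leaves l \<and> b \<in> leaves l)" "\<not> (a \<in> leaves r \<and> b \<in> leaves r)"
    using disj by blast+
  ultimately show ?thesis
    using that[of a b] by auto
qed

text \<open>Conversely, a product at the root admits no edge whose cluster is everything.\<close>
lemma Lam_if_crossing_edge:
  assumes "pairing E (Node g l r) \<noteq> (0 :: 'k::field)" "shuffle_tree (Node g l r)"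
    and "(a, b) \<in> set E" "a \<in> leaves l \<union> leaves r" "b \<in> leaves l \<union> leaves r"
    and "cluster (Node g l r) a b = leaves l \<union> leaves r"
  shows "g = Lam"
proof (rule ccontr)
  assume "g \<noteq> Lam"
  then have "arrows E (leaves l) (leaves r) = 0" "arrows E (leaves r) (leaves l) = 0"
    using pairing_Node_nonzero(1)[OF assms(1)] by auto
  then have "a \<in> leaves l \<and> b \<in> leaves l \<or> a \<in> leaves r \<and> b \<in> leaves r"
    using assms(3-5) by (auto simp: arrows_eq_0_iff)
  moreover have disj: "leaves l \<inter> leaves r = {}" using assms(2) by simp
  ultimately have "cluster (Node g l r) a b \<subseteq> leaves l \<or> cluster (Node g l r) a b \<subseteq> leaves r"
    using cluster_subset[of l a b] cluster_subset[of r a b] by auto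
  then show False
    using assms(6) disj leaves_nonempty[of l] leaves_nonempty[of r] by blast
qed

text \<open>The leaf set of a bracket tree is the cluster of an edge, hence also the leaf set of a subtree of the
  other tree.\<close>
lemma mu_free_not_separated:
  assumes u: "mu_free u" "shuffle_tree u" "pairing E u \<noteq> (0 :: 'k::field)"
    and sub: "leaves u \<subseteq> leaves l \<union> leaves r" "leaves u \<noteq> leaves l \<union> leaves r"
    and s: "shuffle_tree (Node g l r)"
    and eq: "\<And>a b. (a, b) \<in> set E \<Longrightarrow> a \<in> leaves u \<Longrightarrow> b \<in> leaves u \<Longrightarrow>
      cluster (Node g l r) a b = cluster u a b"
  shows "leaves u \<subseteq> leaves l \<or> leaves u \<subseteq> leaves r"
proof (cases u)
  case (Leaf c)
  then show ?thesis using sub by auto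
next
  case (Node h l' r')
  then have "h = Lam" using u by simp
  then obtain a b where ab: "(a, b) \<in> set E" "a \<in> leaves u" "b \<in> leaves u" "cluster u a b = leaves u"
    using Lam_crossing_edge[of E l' r', where 'k = 'k] u Node by auto
  have "cluster (Node g l r) a b = leaves u" using eq[OF ab(1-3)] ab(4) by simp
  then show ?thesis
    using sub(2) cluster_subset[of l a b] cluster_subset[of r a b]
    by (cases rule: cluster_Node_cases[OF s, of a b]) auto
qed

text \<open>Equal clusters force equal labels at the roots, and force a bracket subtree of \<open>t\<close> to stay together
  in \<open>s\<close>. If the left subtrees have the same leaves, both sides are compared recursively. Otherwise the
  root is a product, and the left subtree of \<open>s\<close> contains further leaves besides those of the first
  bracket tree of \<open>t\<close>; its root must then be a product as well, so the least leaf of \<open>s\<close> is below at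
  least two products, and below only one in \<open>t\<close>.\<close>
lemma compare_count_Mu:
  assumes "normal_tree t" "shuffle_tree t" "shuffle_tree s" "leaves s = leaves t"
    and "pairing E t \<noteq> (0 :: 'k::field)" "pairing E s \<noteq> (0 :: 'k)"
    and "\<And>a b. (a, b) \<in> set E \<Longrightarrow> a \<in> leaves t \<Longrightarrow> b \<in> leaves t \<Longrightarrow> cluster s a b = cluster t a b"
  shows "s = t \<or> first_rise (leaves t) (\<lambda>v. count_above Mu t v v) (\<lambda>v. count_above Mu s v v)"
  using assms
proof (induction t arbitrary: s)
  case (Leaf c)
  have "s = Leaf c"
  proof (cases s)
    case (Node g l r)
    then have "leaves l \<subseteq> {c}" "leaves r \<subseteq> {c}" "leaves l \<inter> leaves r = {}"
      using Leaf.prems by auto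
    then show ?thesis
      using leaves_nonempty[of l] leaves_nonempty[of r] by blast
  qed (use Leaf in auto)
  then show ?case ..
next
  case (Node g l r)
  let ?t = "Node g l r"
  have disj: "leaves l \<inter> leaves r = {}" and sub: "shuffle_tree l" "shuffle_tree r"
    and lt: "Min (leaves l) < Min (leaves r)"
    using Node.prems(2) by auto
  have normal: "normal_tree l" "normal_tree r" "mu_free l" using Node.prems(1) by auto
  note nz = pairing_Node_nonzero[OF Node.prems(5)]
  show ?case
  proof (cases s)
    case (Leaf c)
    then have "leaves l \<subseteq> {c}" "leaves r \<subseteq> {c}"
      using Node.prems(4) by auto
    then show ?thesis
      using disj leaves_nonempty[of l] leaves_nonempty[of r] by blast
  next
    case s: (Node g' l' r')
    have disj': "leaves l' \<inter> leaves r' = {}" and sub': "shuffle_tree l'" "shuffle_tree r'"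
      and lt': "Min (leaves l') < Min (leaves r')"
      using Node.prems(3) s by auto
    have all: "leaves l' \<union> leaves r' = leaves l \<union> leaves r"
      using Node.prems(4) s by simp
    note shuffle_s = Node.prems(3)[unfolded s]
    note nz' = pairing_Node_nonzero[OF Node.prems(6)[unfolded s]]
    have clusters: "cluster (Node g' l' r') a b = cluster ?t a b"
      if "(a, b) \<in> set E" "a \<in> leaves l \<union> leaves r" "b \<in> leaves l \<union> leaves r" for a b
      using Node.prems(7)[of a b] that s by simp
    have cl: "cluster ?t a b = cluster l a b" if "a \<in> leaves l" "b \<in> leaves l" for a b
      using that by simp
    have cr: "cluster ?t a b = cluster r a b" if "a \<in> leaves r" "b \<in> leaves r" for a b
      using that disj by auto
    have clusters_l: "cluster (Node g' l' r') a b = cluster l a b"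
      if "(a, b) \<in> set E" "a \<in> leaves l" "b \<in> leaves l" for a b
      using clusters[of a b] cl[of a b] that by (simp del: cluster.simps)
    have clusters_r: "cluster (Node g' l' r') a b = cluster r a b"
      if "(a, b) \<in> set E" "a \<in> leaves r" "b \<in> leaves r" for a b
      using clusters[of a b] cr[of a b] that by (simp del: cluster.simps)
    have proper: "leaves l \<noteq> leaves l' \<union> leaves r'" "leaves r \<noteq> leaves l' \<union> leaves r'"
      unfolding all using disj leaves_nonempty[of l] leaves_nonempty[of r] by blast+
    have "g' = g"
    proof -
      have "g' = Lam" if g: "g = Lam"
      proof -
        obtain a b where ab: "(a, b) \<in> set E" "a \<in> leaves l \<union> leaves r" "b \<in> leaves l \<union> leaves r"
          "cluster (Node Lam l r) a b = leaves l \<union> leaves r"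
          using Lam_crossing_edge[of E l r, where 'k = 'k] Node.prems(2,5) g by auto
        show ?thesis
          by (rule Lam_if_crossing_edge[OF Node.prems(6)[unfolded s] shuffle_s ab(1)])
            (use ab clusters[OF ab(1-3)] g all in \<open>auto simp del: cluster.simps\<close>)
      qed
      moreover have "g = Lam" if g': "g' = Lam"
      proof -
        obtain a b where ab: "(a, b) \<in> set E" "a \<in> leaves l' \<union> leaves r'" "b \<in> leaves l' \<union> leaves r'"
          "cluster (Node Lam l' r') a b = leaves l' \<union> leaves r'"
          using Lam_crossing_edge[of E l' r', where 'k = 'k] shuffle_s Node.prems(6) s g' by auto
        show ?thesis
          by (rule Lam_if_crossing_edge[OF Node.prems(5) Node.prems(2) ab(1)])
            (use ab clusters[of a b] g' all in \<open>auto simp del: cluster.simps\<close>)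
      qed
      ultimately show ?thesis by (cases g; cases g') auto
    qed
    have Min_all: "Min (leaves l \<union> leaves r) = Min (leaves l)" "Min (leaves l' \<union> leaves r') = Min (leaves l')"
      using lt lt' by (simp_all add: Min_Un del: Min_gr_iff)
    then have Min_eq: "Min (leaves l') = Min (leaves l)" using all by simp
    have m_in: "Min (leaves l) \<in> leaves l" "Min (leaves l) \<in> leaves l'"
      using Min_in[OF finite_leaves leaves_nonempty, of l] Min_in[OF finite_leaves leaves_nonempty, of l']
      unfolding Min_eq by blast+
    have "leaves l \<subseteq> leaves l' \<or> leaves l \<subseteq> leaves r'"
      using normal(3) sub(1) nz(2) _ proper(1) shuffle_s clusters_l
      by (rule mu_free_not_separated) (use all in auto)
    then have l_sub: "leaves l \<subseteq> leaves l'" using m_in disj' by blast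
    show ?thesis
    proof (cases "leaves l = leaves l'")
      case False
      have "g = Mu"
      proof (rule ccontr)
        assume "g \<noteq> Mu"
        then have "g = Lam" by (cases g) auto
        then have "mu_free r" using Node.prems(1) by simp
        then have "leaves r \<subseteq> leaves l' \<or> leaves r \<subseteq> leaves r'"
          using sub(2) nz(3) _ proper(2) shuffle_s clusters_r
          by (rule mu_free_not_separated) (use all in auto)
        then show False
          using False l_sub all disj disj' leaves_nonempty[of r'] by blast
      qed
      obtain h A B where l': "l' = Node h A B"
      proof (cases l')
        case (Leaf c)
        then show ?thesis using False l_sub m_in by auto
      qed
      have "h = Mu"
      proof (rule ccontr)
        assume "h \<noteq> Mu"
        then have h: "h = Lam" by (cases h) auto
        obtain a b where ab: "(a, b) \<in> set E" "a \<in> leaves l'" "b \<in> leaves l'" "cluster l' a b = leaves l'"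
          using Lam_crossing_edge[of E A B, where 'k = 'k] nz'(2) sub'(1) l' h by auto
        have "cluster ?t a b = leaves l'"
        proof -
          have "a \<in> leaves l \<union> leaves r" "b \<in> leaves l \<union> leaves r"
            using ab(2,3) unfolding all[symmetric] by blast+
          from clusters[OF ab(1) this] have "cluster ?t a b = cluster (Node g' l' r') a b" ..
          also have "\<dots> = leaves l'"
            using ab(2-4) by simp
          finally show ?thesis .
        qed
        moreover have "\<not> leaves l' \<subseteq> leaves r" "\<not> leaves l' \<subseteq> leaves l"
          using m_in disj False l_sub by blast+
        moreover have "leaves l' \<noteq> leaves l \<union> leaves r"
          using all disj' leaves_nonempty[of r'] by blast
        ultimately show False
          using cluster_subset[of l a b] cluster_subset[of r a b]
          by (cases rule: cluster_Node_cases[OF Node.prems(2), of a b]) (simp_all del: cluster.simps)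
      qed
      have "Min (leaves l) \<in> leaves A"
      proof -
        have "Min (leaves A) < Min (leaves B)" using sub'(1) l' by simp
        then have "Min (leaves l') = Min (leaves A)"
          unfolding l' by (simp add: Min_Un del: Min_gr_iff)
        then show ?thesis
          using Min_in[OF finite_leaves leaves_nonempty, of A] Min_eq by simp
      qed
      then have "count_above Mu s (Min (leaves l)) (Min (leaves l)) \<ge> 2"
        using m_in(2) s \<open>g' = g\<close> \<open>g = Mu\<close> \<open>h = Mu\<close> l' by simp
      moreover have "count_above Mu ?t (Min (leaves l)) (Min (leaves l)) = 1"
        using m_in(1) normal(3) \<open>g = Mu\<close> by (simp add: count_Mu_mu_free)
      moreover have "\<not> u < Min (leaves l)" if "u \<in> leaves ?t" for u
        using that Min_all(1) by (metis Min_le finite_leaves not_less optree.set(2))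
      ultimately show ?thesis
        using m_in(1) unfolding first_rise_def
        by (intro disjI2 bexI[of _ "Min (leaves l)"]) auto
    next
      case l_eq: True
      then have r_eq: "leaves r = leaves r'" using all disj disj' by blast
      have IHl: "l' = l \<or> first_rise (leaves l) (\<lambda>v. count_above Mu l v v) (\<lambda>v. count_above Mu l' v v)"
        using clusters_l l_eq
        by (intro Node.IH(1)[OF normal(1) sub(1) sub'(1) _ nz(2) nz'(2)]) auto
      have IHr: "r' = r \<or> first_rise (leaves r) (\<lambda>v. count_above Mu r v v) (\<lambda>v. count_above Mu r' v v)"
      proof (rule Node.IH(2)[OF normal(2) sub(2) sub'(2) _ nz(3) nz'(3)])
        fix a b assume "(a, b) \<in> set E" "a \<in> leaves r" "b \<in> leaves r"
        then show "cluster r' a b = cluster r a b"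
          using clusters_r[of a b] r_eq disj' by (simp add: disjoint_iff) metis
      qed (use r_eq in auto)
      have cnt_l: "count_above Mu ?t v v = of_bool (g = Mu) + count_above Mu l v v"
        "count_above Mu s v v = of_bool (g = Mu) + count_above Mu l' v v" if "v \<in> leaves l" for v
        using that l_eq s \<open>g' = g\<close> by (auto simp: eq_commute)
      have cnt_r: "count_above Mu ?t v v = of_bool (g = Mu) + count_above Mu r v v"
        "count_above Mu s v v = of_bool (g = Mu) + count_above Mu r' v v" if "v \<in> leaves r" for v
        using that r_eq l_eq disj s \<open>g' = g\<close> by (auto simp: eq_commute)
      let ?x = "\<lambda>v. count_above Mu ?t v v" and ?y = "\<lambda>v. count_above Mu s v v"
      have l: "l' = l \<and> (\<forall>v\<in>leaves l. ?x v = ?y v) \<or> first_rise (leaves l) ?x ?y"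
        using IHl
      proof
        assume "first_rise (leaves l) (\<lambda>v. count_above Mu l v v) (\<lambda>v. count_above Mu l' v v)"
        then show ?thesis
          by (subst first_rise_shift[OF cnt_l]) auto
      qed (use cnt_l in auto)
      have r: "r' = r \<and> (\<forall>v\<in>leaves r. ?x v = ?y v) \<or> first_rise (leaves r) ?x ?y"
        using IHr
      proof
        assume "first_rise (leaves r) (\<lambda>v. count_above Mu r v v) (\<lambda>v. count_above Mu r' v v)"
        then show ?thesis
          by (subst first_rise_shift[OF cnt_r]) auto
      qed (use cnt_r in auto)
      consider "l' = l" "r' = r" | "first_rise (leaves l) ?x ?y" | "first_rise (leaves r) ?x ?y"
        using l r by blast
      then show ?thesis
      proof cases
        case 1
        then show ?thesis using s \<open>g' = g\<close> by simp
      next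
        case 2
        have "first_rise (leaves l \<union> leaves r) ?x ?y"
          by (rule first_rise_Un[OF 2]) (use r in blast)
        then show ?thesis by (simp only: optree.set simp_thms)
      next
        case 3
        have "first_rise (leaves r \<union> leaves l) ?x ?y"
          by (rule first_rise_Un[OF 3]) (use l in blast)
        then show ?thesis by (simp only: optree.set Un_commute simp_thms)
      qed
    qed
  qed
qed

text \<open>The first difference of the keys is excluded at every stage: at stage 0 by \<open>count_Lam_le\<close>, later by
  \<open>compare_count_Mu\<close> applied to the clusters, which agree because stage 0 is passed.\<close>
lemma pairing_edges_triangular:
  assumes t: "t \<in> tree_monomials n" "normal_tree t" and s: "s \<in> tree_monomials n"
    and less: "first_diff_less (key s) (key t)"
  shows "pairing (edges t) s = (0 :: 'k::field)"
proof (rule ccontr)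
  assume nonzero: "pairing (edges t) s \<noteq> (0 :: 'k)"
  have shuffle: "shuffle_tree t" "shuffle_tree s" and L: "leaves t = {1..n}" "leaves s = leaves t"
    using t s by (auto simp: tree_monomials_def)
  obtain c i j where diff: "key s (c, i, j) < key t (c, i, j)"
    and before: "\<forall>q<(c, i, j). key s q = key t q"
    using first_diff_less_triple[OF less] by blast
  have i: "i \<in> leaves t"
    using key_outside[OF t(1), of i j c] key_outside[OF s, of i j c] diff unfolding L(1) by (metis less_irrefl)
  have diag: "c = 0 \<or> c = 1 \<Longrightarrow> i = j"
    using diff by (auto split: if_splits)
  have Lam_before: "count_above Lam s u u = count_above Lam t u u" if "0 < c \<or> u < i" for u
  proof -
    have "(0, u, u) < (c, i, j)"
      using that diag unfolding triple_less_iff by auto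
    then have "key s (0, u, u) = key t (0, u, u)" using before by blast
    then show ?thesis by simp
  qed
  show False
  proof (cases "c = 0")
    case True
    then have "count_above Lam s i i < count_above Lam t i i"
      using diff diag by simp
    moreover have "count_above Lam t i i \<le> count_above Lam s i i"
      using count_Lam_le[OF t(2) shuffle L(2) nonzero i] Lam_before by blast
    ultimately show False by simp
  next
    case False
    have Mu_before: "count_above Mu s u u = count_above Mu t u u" if "1 < c \<or> c = 1 \<and> u < i" for u
    proof -
      have "(1, u, u) < (c, i, j)"
        using that diag unfolding triple_less_iff by auto
      then have "key s (1, u, u) = key t (1, u, u)" using before by blast
      then show ?thesis by simp
    qed
    have "cluster s a b = cluster t a b" if "(a, b) \<in> set (edges t)" for a b
      using clusters_eq[OF t(2) shuffle L(2) nonzero _ that] Lam_before False by blast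
    then have "s = t \<or> first_rise (leaves t) (\<lambda>v. count_above Mu t v v) (\<lambda>v. count_above Mu s v v)"
      using compare_count_Mu[OF t(2) shuffle L(2) _ nonzero] pairing_edges_self[OF shuffle(1), where 'k = 'k] by auto
    moreover have "s \<noteq> t" using less first_diff_less_irrefl by blast
    ultimately obtain v where v: "count_above Mu t v v < count_above Mu s v v"
      "\<And>u. u \<in> leaves t \<Longrightarrow> u < v \<Longrightarrow> count_above Mu t u u = count_above Mu s u u"
      unfolding first_rise_def by blast
    show False
    proof (cases "c = 1")
      case True
      then have "count_above Mu s i i < count_above Mu t i i"
        using diff diag by simp
      then show False
        using v(1) v(2)[OF i] Mu_before[of v] True by (cases i v rule: linorder_cases) auto
    next
      case False
      then show False
        using v(1) Mu_before[of v] \<open>c \<noteq> 0\<close> by simp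
    qed
  qed
qed

section \<open>Divisibility by the leading monomials\<close>

text \<open>The root and one of its children match one of the six leading monomials. The order of the subtrees
  matters only for a bracket in the left argument of a bracket; for the other left-nested patterns
  both orders give a leading monomial.\<close>
fun root_reducible :: "nat optree \<Rightarrow> bool" where
  "root_reducible (Node Lam l r) \<longleftrightarrow>
     (\<exists>A B. l = Node Mu A B) \<or> (\<exists>A B. r = Node Mu A B) \<or>
     (\<exists>A B. l = Node Lam A B \<and> Min (leaves B) < Min (leaves r))"
| "root_reducible (Node Mu l r) \<longleftrightarrow> (\<exists>A B. l = Node Mu A B)"
| "root_reducible (Leaf a) \<longleftrightarrow> False"

primrec reducible :: "nat optree \<Rightarrow> bool" where
  "reducible (Leaf a) \<longleftrightarrow> False"
| "reducible (Node g l r) \<longleftrightarrow> root_reducible (Node g l r) \<or> reducible l \<or> reducible r"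

lemma irreducible_mu_free:
  "\<not> reducible t \<Longrightarrow> \<forall>A B. t \<noteq> Node Mu A B \<Longrightarrow> mu_free t"
proof (induction t)
  case (Node g l r)
  then have "g = Lam" by (cases g) auto
  with Node show ?case by auto
qed simp

text \<open>Without a pattern no product is below a bracket and no product is the left child of a product. The
  comparison of least leaves at a bracket propagates down the left spine: the least right leaf grows at each
  step, so it bounds all leaves of the left subtree but the first.\<close>
lemma irreducible_normal:
  assumes "shuffle_tree t" "\<not> reducible t"
  shows "normal_tree t"
  using assms
proof (induction t)
  case (Node g l r)
  have normal: "normal_tree l" "normal_tree r" using Node by auto
  have irr: "\<not> reducible l" "\<not> reducible r" "\<not> root_reducible (Node g l r)"
    using Node.prems(2) by auto
  have l: "mu_free l"
    using irr by (intro irreducible_mu_free) (cases g; auto)+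
  show ?case
  proof (cases g)
    case Mu
    then show ?thesis using normal l by simp
  next
    case Lam
    have r: "mu_free r"
      using irr Lam by (intro irreducible_mu_free) auto
    have "Min (leaves r) < v" if v: "v \<in> leaves l" "v \<noteq> Min (leaves l)" for v
    proof (cases l)
      case (Leaf a)
      then show ?thesis using v by simp
    next
      case (Node h A B)
      then have "h = Lam" using l by simp
      have "leaves B \<inter> leaves r = {}"
        using Node.prems(1) Node by auto
      then have "Min (leaves B) \<noteq> Min (leaves r)"
        using Min_in[OF finite_leaves leaves_nonempty, of B] Min_in[OF finite_leaves leaves_nonempty, of r]
        by (metis disjoint_iff)
      moreover have "\<not> Min (leaves B) < Min (leaves r)"
        using irr(3) Lam Node \<open>h = Lam\<close> by (simp del: Min_gr_iff)
      ultimately have less: "Min (leaves r) < Min (leaves B)" by linarith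
      have "Min (leaves A) < Min (leaves B)" using Node.prems(1) Node by simp
      then have "Min (leaves l) = Min (leaves A)"
        unfolding Node by (simp add: Min_Un del: Min_gr_iff)
      then consider "v \<in> leaves A" "v \<noteq> Min (leaves A)" | "v \<in> leaves B"
        using v Node by auto
      then have "Min (leaves B) \<le> v"
      proof cases
        case 1
        then show ?thesis using normal(1) Node \<open>h = Lam\<close> by (simp add: less_imp_le)
      qed simp
      then show ?thesis using less by linarith
    qed
    then show ?thesis
      using normal l r Lam by simp
  qed
qed simp

definition leading_trees :: "nat optree set" where
  "leading_trees =
    {mu (mu a1 a2) a3, mu (mu a1 a3) a2, lam (lam a1 a2) a3,
     lam a1 (mu a2 a3), lam (mu a1 a2) a3, lam (mu a1 a3) a2}"

lemma interval_1_3: "{1..3} = {1, 2, 3 :: nat}"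
  by auto

lemma comb_tree_monomials:
  "Node g (Node h a1 a2) a3 \<in> tree_monomials 3"
  "Node g (Node h a1 a3) a2 \<in> tree_monomials 3"
  "Node g a1 (Node h a2 a3) \<in> tree_monomials 3"
  by (auto simp: tree_monomials_def interval_1_3)

text \<open>The three subtrees are listed by increasing least leaf, which is what a shuffle composition
  requires of the blocks.\<close>
lemma graft3_divisible:
  assumes "p \<in> tree_monomials 3" "shuffle_tree A" "shuffle_tree B" "shuffle_tree C"
    and "leaves A \<union> leaves B \<union> leaves C = {1..m}"
    and "leaves A \<inter> leaves B = {}" "leaves A \<inter> leaves C = {}" "leaves B \<inter> leaves C = {}"
    and "Min (leaves A) < Min (leaves B)" "Min (leaves B) < Min (leaves C)"
  shows "tree_divides p (graft p (\<lambda>i. if i = 1 then A else if i = 2 then B else C))"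
proof -
  let ?U = "\<lambda>i::nat. if i = 1 then A else if i = 2 then B else C"
  have i3: "i \<in> {1..3} \<longleftrightarrow> i = 1 \<or> i = 2 \<or> i = 3" for i :: nat by auto
  have cover: "(\<Union>i\<in>{1..3}. leaves (?U i)) = {1..m}"
    unfolding interval_1_3 using assms(5) by auto
  obtain f where f: "shuffle_surj m 3 f"
      "\<And>i. i \<in> {1..3} \<Longrightarrow> standardize (?U i) \<in> tree_monomials (card (fiber m f i))"
      "\<And>p. p \<in> tree_monomials 3 \<Longrightarrow> tree_comp m f p (\<lambda>i. standardize (?U i)) = graft p ?U"
  proof (rule graft_eq_tree_comp[of 3 ?U m])
    show "shuffle_tree (?U i)" for i using assms(2-4) by simp
    show "leaves (?U i) \<inter> leaves (?U j) = {}" "Min (leaves (?U i)) < Min (leaves (?U j))"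
      if "i \<in> {1..3}" "j \<in> {1..3}" "i < j" for i j
      using that assms(6-10) less_trans[OF assms(9,10)] unfolding i3 by (auto simp del: Min_gr_iff)
  qed (use cover in auto)
  have "tree_divides p (tree_comp m f p (\<lambda>i. standardize (?U i)))"
    by (rule tree_divides.comp_root[OF f(1) assms(1) tree_divides.refl]) (use f(2) in blast)
  then show ?thesis using f(3)[OF assms(1)] by simp
qed

lemma root_reducible_divisible:
  assumes "root_reducible t" "t \<in> tree_monomials m"
  shows "\<exists>p\<in>leading_trees. tree_divides p t"
proof -
  have t: "shuffle_tree t" "leaves t = {1..m}" using assms(2) by (auto simp: tree_monomials_def)
  have left: "\<exists>p\<in>{Node g (Node h a1 a2) a3, Node g (Node h a1 a3) a2}. tree_divides p t"
    if eq: "t = Node g (Node h A B) C" for g h A B C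
  proof -
    have tr: "shuffle_tree A" "shuffle_tree B" "shuffle_tree C"
      and disj: "leaves A \<inter> leaves B = {}" "leaves A \<inter> leaves C = {}" "leaves B \<inter> leaves C = {}"
      and cover: "leaves A \<union> leaves B \<union> leaves C = {1..m}" and AB: "Min (leaves A) < Min (leaves B)"
      using t eq by (auto simp del: Min_gr_iff)
    have "Min (leaves A \<union> leaves B) = Min (leaves A)"
      using AB by (simp add: Min_Un del: Min_gr_iff)
    then have AC: "Min (leaves A) < Min (leaves C)"
      using t(1) eq by (simp del: Min_gr_iff)
    have "Min (leaves B) \<noteq> Min (leaves C)"
      using disj(3) Min_in[OF finite_leaves leaves_nonempty, of B] Min_in[OF finite_leaves leaves_nonempty, of C]
      by (metis disjoint_iff)
    then consider "Min (leaves B) < Min (leaves C)" | "Min (leaves C) < Min (leaves B)" by linarith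
    then show ?thesis
    proof cases
      case 1
      have "tree_divides (Node g (Node h a1 a2) a3) (graft (Node g (Node h a1 a2) a3)
          (\<lambda>i. if i = 1 then A else if i = 2 then B else C))"
        using 1 tr disj cover AB by (intro graft3_divisible comb_tree_monomials)
      then show ?thesis using eq by simp
    next
      case 2
      have "leaves A \<union> leaves C \<union> leaves B = {1..m}" "leaves C \<inter> leaves B = {}" using cover disj by auto
      then have "tree_divides (Node g (Node h a1 a3) a2) (graft (Node g (Node h a1 a3) a2)
          (\<lambda>i. if i = 1 then A else if i = 2 then C else B))"
        using 2 tr disj AC by (intro graft3_divisible comb_tree_monomials)
      then show ?thesis using eq by simp
    qed
  qed
  have right: "tree_divides (Node g a1 (Node h a2 a3)) t" if eq: "t = Node g A (Node h B C)" for g h A B C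
  proof -
    have tr: "shuffle_tree A" "shuffle_tree B" "shuffle_tree C"
      and disj: "leaves A \<inter> leaves B = {}" "leaves A \<inter> leaves C = {}" "leaves B \<inter> leaves C = {}"
      and cover: "leaves A \<union> leaves B \<union> leaves C = {1..m}" and BC: "Min (leaves B) < Min (leaves C)"
      using t eq by (auto simp del: Min_gr_iff)
    have "Min (leaves B \<union> leaves C) = Min (leaves B)"
      using BC by (simp add: Min_Un del: Min_gr_iff)
    then have AB: "Min (leaves A) < Min (leaves B)"
      using t(1) eq by (simp del: Min_gr_iff)
    have "tree_divides (Node g a1 (Node h a2 a3)) (graft (Node g a1 (Node h a2 a3))
        (\<lambda>i. if i = 1 then A else if i = 2 then B else C))"
      using tr disj cover AB BC by (intro graft3_divisible comb_tree_monomials)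
    then show ?thesis using eq by simp
  qed
  show ?thesis
  proof (cases t)
    case (Node g l r)
    have outer: "Min (leaves l) < Min (leaves r)" using t Node by simp
    consider (Mu_left) A B where "t = Node g (Node Mu A B) r"
      | (Mu_right) A B where "g = Lam" "t = Node g l (Node Mu A B)"
      | (Lam_left) A B where "g = Lam" "t = Node g (Node Lam A B) r" "Min (leaves B) < Min (leaves r)"
      using assms(1) Node by (cases g) (auto simp del: Min_gr_iff)
    then show ?thesis
    proof cases
      case Mu_left
      then show ?thesis using left[OF Mu_left] by (cases g) (auto simp: leading_trees_def)
    next
      case Mu_right
      then show ?thesis using right[OF Mu_right(2)] by (auto simp: leading_trees_def)
    next
      case Lam_left
      have "tree_divides (Node g (Node Lam a1 a2) a3) (graft (Node g (Node Lam a1 a2) a3)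
          (\<lambda>i. if i = 1 then A else if i = 2 then B else r))"
        using t Lam_left by (intro graft3_divisible comb_tree_monomials) (auto simp del: Min_gr_iff)
      then show ?thesis using Lam_left by (auto simp: leading_trees_def)
    qed
  qed (use assms(1) in simp)
qed

lemma internal_vertices_relabel: "internal_vertices (relabel h t) = internal_vertices t"
  by (induction t) auto

lemma root_reducible_relabel:
  assumes "strict_mono_on (leaves t) h" "root_reducible t"
  shows "root_reducible (relabel h t)"
proof (cases t)
  case (Node g l r)
  have Min_less: "Min (h ` leaves B) < Min (h ` leaves r)"
    if "leaves B \<subseteq> leaves l" "Min (leaves B) < Min (leaves r)" for B
  proof -
    have "strict_mono_on (leaves B) h" "strict_mono_on (leaves r) h"
      using assms(1) that Node by (auto intro: monotone_on_subset)
    moreover have "h (Min (leaves B)) < h (Min (leaves r))"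
      using that Node Min_in[OF finite_leaves leaves_nonempty, of B] Min_in[OF finite_leaves leaves_nonempty, of r]
      by (intro strict_mono_onD[OF assms(1)]) auto
    ultimately show ?thesis
      by (simp add: Min_image_strict_mono_on del: Min_gr_iff)
  qed
  show ?thesis
    using assms(2) Min_less unfolding Node
    by (cases g) (auto simp: optree.set_map simp del: Min_gr_iff)
qed (use assms in simp)

lemma reducible_relabel:
  "strict_mono_on (leaves t) h \<Longrightarrow> reducible t \<Longrightarrow> reducible (relabel h t)"
proof (induction t)
  case (Node g l r)
  have "strict_mono_on (leaves l) h" "strict_mono_on (leaves r) h"
    using Node.prems(1) by (auto intro: monotone_on_subset)
  then show ?case
    using Node root_reducible_relabel[OF Node.prems(1)] by auto
qed simp

text \<open>A pattern away from the root lies in a subtree; its standardization is an argument of a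
  composition with a single vertex.\<close>
lemma reducible_divisible:
  "reducible t \<Longrightarrow> t \<in> tree_monomials m \<Longrightarrow> \<exists>p\<in>leading_trees. tree_divides p t"
proof (induction "internal_vertices t" arbitrary: t m rule: less_induct)
  case less
  show ?case
  proof (cases "root_reducible t")
    case True
    then show ?thesis using root_reducible_divisible less.prems by blast
  next
    case False
    then obtain g l r where t: "t = Node g l r" and red: "reducible l \<or> reducible r"
      using less.prems(1) by (cases t) auto
    have shuffle: "shuffle_tree t" "leaves t = {1..m}"
      using less.prems(2) by (auto simp: tree_monomials_def)
    let ?U = "\<lambda>i::nat. if i = 1 then l else r"
    have i2: "i \<in> {1..2} \<longleftrightarrow> i = 1 \<or> i = 2" for i :: nat by auto
    have cover: "(\<Union>i\<in>{1..2}. leaves (?U i)) = {1..m}"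
    proof -
      have "{1..2} = {1, 2 :: nat}" by auto
      then show ?thesis using shuffle t by simp
    qed
    obtain f where f: "shuffle_surj m 2 f"
      "\<And>i. i \<in> {1..2} \<Longrightarrow> standardize (?U i) \<in> tree_monomials (card (fiber m f i))"
      "\<And>p. p \<in> tree_monomials 2 \<Longrightarrow> tree_comp m f p (\<lambda>i. standardize (?U i)) = graft p ?U"
    proof (rule graft_eq_tree_comp[of 2 ?U m])
      show "shuffle_tree (?U i)" for i using shuffle t by simp
      show "leaves (?U i) \<inter> leaves (?U j) = {}" "Min (leaves (?U i)) < Min (leaves (?U j))"
        if "i \<in> {1..2}" "j \<in> {1..2}" "i < j" for i j
        using that shuffle t unfolding i2 by (auto simp del: Min_gr_iff)
    qed (use cover in auto)
    have corolla: "Node g a1 a2 \<in> tree_monomials 2" by (auto simp: tree_monomials_def)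
    obtain i where i: "i \<in> {1..2}" "reducible (?U i)"
      using red by (cases "reducible l") (auto intro: that[of 1] that[of 2])
    have "reducible (standardize (?U i))"
      unfolding standardize_def
      by (intro reducible_relabel the_inv_into_enumerate_strict_mono finite_leaves i(2))
    moreover have "internal_vertices (standardize (?U i)) < internal_vertices t"
      using t by (simp add: standardize_def internal_vertices_relabel)
    ultimately obtain p where p: "p \<in> leading_trees" "tree_divides p (standardize (?U i))"
      using less.hyps f(2)[OF i(1)] by blast
    have "tree_divides p (tree_comp m f (Node g a1 a2) (\<lambda>i. standardize (?U i)))"
      by (rule tree_divides.comp_arg[where i = i, OF f(1) corolla _ i(1)]) (use f(2) p(2) in blast)+
    then show ?thesis
      using p(1) f(3)[OF corolla] t by auto
  qed
qed

section \<open>The Groebner basis\<close>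

lemmas lookup_simps = lookup_add lookup_minus lookup_uminus lookup_single when_def

lemma poisson_identity_keys:
  assumes "x \<in> poisson_identities" "t \<in> Poly_Mapping.keys (x :: 'k::field lincomb)"
  shows "\<exists>g h. t \<in> {Node g (Node h a1 a2) a3, Node g (Node h a1 a3) a2, Node g a1 (Node h a2 a3)}"
proof -
  have "Poly_Mapping.lookup x t \<noteq> 0"
    using assms(2) by (simp add: in_keys_iff)
  then have "t \<in> {mu (mu a1 a2) a3, mu a1 (mu a2 a3), lam a1 (mu a2 a3), mu (lam a1 a2) a3,
      mu (lam a1 a3) a2, lam a1 (lam a2 a3), lam (lam a1 a2) a3, lam (lam a1 a3) a2}"
    using assms(1) unfolding poisson_identities_def
    by (elim insertE emptyE; hypsubst; simp only: lookup_simps split: if_splits) simp_all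
  then show ?thesis by blast
qed

lemma shuffle_form_comb_tree_monomials:
  assumes "p \<noteq> q" "p \<noteq> r" "q \<noteq> r" "{p, q, r} = {1..3}"
  shows "shuffle_form (Node g (Node h (Leaf p) (Leaf q)) (Leaf r)) \<in> tree_monomials 3"
    and "shuffle_form (Node g (Leaf p) (Node h (Leaf q) (Leaf r))) \<in> tree_monomials 3"
  using assms by (auto simp: tree_monomials_def)

lemma poisson_relations_keys:
  assumes "x \<in> poisson_relations n" "t \<in> Poly_Mapping.keys (x :: 'k::field lincomb)"
  shows "n = 3 \<and> t \<in> tree_monomials 3 \<and> internal_vertices t = 2"
proof -
  obtain \<sigma> y where n: "n = 3" and x: "x = permute_rewrite \<sigma> y" and \<sigma>: "\<sigma> permutes {1..3}"
    and y: "y \<in> poisson_identities"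
    using assms(1) by (auto simp: poisson_relations_def split: if_splits)
  obtain s where s: "s \<in> Poly_Mapping.keys y" "t = shuffle_form (relabel \<sigma> s)"
    using assms(2) unfolding x permute_rewrite_def
    by (auto dest!: subsetD[OF keys_sum] split: if_splits)
  have distinct: "\<sigma> 1 \<noteq> \<sigma> 2" "\<sigma> 1 \<noteq> \<sigma> 3" "\<sigma> 2 \<noteq> \<sigma> 3"
    using permutes_inj[OF \<sigma>] by (simp_all add: inj_eq)
  have image: "{\<sigma> 1, \<sigma> 2, \<sigma> 3} = {1..3}"
    using permutes_image[OF \<sigma>] unfolding interval_1_3 by simp
  obtain g h where "s \<in> {Node g (Node h a1 a2) a3, Node g (Node h a1 a3) a2, Node g a1 (Node h a2 a3)}"
    using poisson_identity_keys[OF y s(1)] by blast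
  then show ?thesis
    using n s(2) distinct image
      shuffle_form_comb_tree_monomials[of "\<sigma> 1" "\<sigma> 2" "\<sigma> 3" g h]
      shuffle_form_comb_tree_monomials(1)[of "\<sigma> 1" "\<sigma> 3" "\<sigma> 2" g h]
    by (auto simp: insert_commute simp del: shuffle_form.simps) auto
qed

text \<open>Vanishing for all graphs at once is needed for the induction, since the graph changes when the
  pairing of a composition is factored.\<close>
lemma generated_ideal_vanishing:
  assumes "generated_ideal poisson_relations n (x :: 'k::field lincomb)"
  shows "x \<in> operad_component n \<and> (\<forall>E. pairing_sum E x = 0)"
  using assms
proof (induction rule: generated_ideal.induct)
  case (generator x n)
  then show ?case
    using poisson_relations_keys[OF generator] pairing_sum_relation[OF generator]
    by (auto simp: operad_component_def)
next
  case (zero n)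
  then show ?case by (simp add: operad_component_def pairing_sum_simps)
next
  case (add n x y)
  then show ?case
    using Poly_Mapping.keys_add[of x y] by (auto simp: operad_component_def pairing_sum_simps)
next
  case (scale n x c)
  have "Poly_Mapping.keys (Poly_Mapping.map (\<lambda>a. c * a) x) \<subseteq> Poly_Mapping.keys x"
    by (auto simp: in_keys_iff Poly_Mapping.map.rep_eq when_def)
  then show ?case
    using scale by (auto simp: operad_component_def pairing_sum_scale)
next
  case (comp_root m n f x ys)
  then show ?case
    by (simp add: shuffle_comp_in_operad_component pairing_sum_shuffle_comp)
next
  case (comp_arg m n f x ys i)
  have "(\<Prod>j\<in>{1..n}. pairing_sum (block_pull m f E j) (ys j)) = 0" for E
    using comp_arg by (intro prod_zero) auto
  then show ?case
    using comp_arg shuffle_comp_in_operad_component[of m n f x ys]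
      pairing_sum_shuffle_comp[of x n ys m f] by simp
qed

lemma poisson_order_Lam:
  assumes "s \<in> tree_monomials n" "t \<in> tree_monomials n"
    and "count_above Lam s i i < count_above Lam t i i"
    and "\<forall>j<i. count_above Lam s j j = count_above Lam t j j"
  shows "(s, t) \<in> poisson_order n"
proof -
  have "first_diff_less (key s) (key t)"
    unfolding first_diff_less_def
  proof (intro exI[of _ "(0, i, i)"] conjI allI impI)
    fix q :: "nat \<times> nat \<times> nat" assume less: "q < (0, i, i)"
    obtain c j k where q: "q = (c, j, k)" by (cases q) auto
    have "c = 0 \<and> (j = k \<longrightarrow> j < i)"
      using less unfolding q triple_less_iff by auto
    then show "key s q = key t q"
      using assms(4) q by simp
  qed (use assms(3) in simp)
  then show ?thesis using assms(1,2) by (simp add: poisson_order_def)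
qed

lemma poisson_order_Mu:
  assumes "s \<in> tree_monomials n" "t \<in> tree_monomials n"
    and "\<forall>j. count_above Lam s j j = count_above Lam t j j"
    and "count_above Mu s i i < count_above Mu t i i"
    and "\<forall>j<i. count_above Mu s j j = count_above Mu t j j"
  shows "(s, t) \<in> poisson_order n"
proof -
  have "first_diff_less (key s) (key t)"
    unfolding first_diff_less_def
  proof (intro exI[of _ "(1, i, i)"] conjI allI impI)
    fix q :: "nat \<times> nat \<times> nat" assume less: "q < (1, i, i)"
    obtain c j k where q: "q = (c, j, k)" by (cases q) auto
    have "c = 0 \<or> c = 1 \<and> (j = k \<longrightarrow> j < i)"
      using less unfolding q triple_less_iff by auto
    then show "key s q = key t q"
      using assms(3,5) q by auto
  qed (use assms(4) in simp)
  then show ?thesis using assms(1,2) by (simp add: poisson_order_def)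
qed

lemma is_leading_monomialI:
  assumes "Poly_Mapping.lookup x t \<noteq> 0" "t \<in> tree_monomials n"
    and "\<And>s. s \<noteq> t \<Longrightarrow> Poly_Mapping.lookup x s \<noteq> 0 \<Longrightarrow> (s, t) \<in> poisson_order n"
  shows "is_leading_monomial poisson_order n x t"
proof -
  have "(s, t) \<in> poisson_order n" if "Poly_Mapping.lookup x s \<noteq> 0" for s
    using assms(2) assms(3)[OF _ that] by (cases "s = t") (simp_all add: poisson_order_def)
  then show ?thesis
    using assms(1) by (simp add: is_leading_monomial_def in_keys_iff)
qed

lemmas small_order_simps = less_Suc_eq numeral_3_eq_3 numeral_2_eq_2

lemma leading_monomial_of_trinomial:
  assumes "Poly_Mapping.lookup x t \<noteq> 0" "t \<in> tree_monomials n"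
    and "\<And>w. w \<notin> {t, u, v} \<Longrightarrow> Poly_Mapping.lookup x w = 0"
    and "(u, t) \<in> poisson_order n" "(v, t) \<in> poisson_order n"
  shows "is_leading_monomial poisson_order n x t"
  using assms by (intro is_leading_monomialI) blast+

text \<open>The witness \<open>i\<close> is the first leaf that has different numbers of brackets above it in the two trees, or
  of products for the purely commutative monomials.\<close>
lemma comb_order:
  "(mu a1 (mu a2 a3), mu (mu a1 a2) a3) \<in> poisson_order 3"
  "(mu a1 (mu a2 a3), mu (mu a1 a3) a2) \<in> poisson_order 3"
  "(lam a1 (lam a2 a3), lam (lam a1 a2) a3) \<in> poisson_order 3"
  "(lam (lam a1 a3) a2, lam (lam a1 a2) a3) \<in> poisson_order 3"
  "(mu (lam a1 a2) a3, lam a1 (mu a2 a3)) \<in> poisson_order 3"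
  "(mu (lam a1 a3) a2, lam a1 (mu a2 a3)) \<in> poisson_order 3"
  "(mu (lam a1 a2) a3, lam (mu a1 a3) a2) \<in> poisson_order 3"
  "(mu a1 (lam a2 a3), lam (mu a1 a3) a2) \<in> poisson_order 3"
  "(mu a1 (lam a2 a3), lam (mu a1 a2) a3) \<in> poisson_order 3"
  "(mu (lam a1 a3) a2, lam (mu a1 a2) a3) \<in> poisson_order 3"
proof -
  show "(mu a1 (mu a2 a3), mu (mu a1 a2) a3) \<in> poisson_order 3"
    by (rule poisson_order_Mu[OF comb_tree_monomials(3) comb_tree_monomials(1), where i = 1]) (auto simp: small_order_simps)
  show "(mu a1 (mu a2 a3), mu (mu a1 a3) a2) \<in> poisson_order 3"
    by (rule poisson_order_Mu[OF comb_tree_monomials(3) comb_tree_monomials(2), where i = 1]) (auto simp: small_order_simps)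
  show "(lam a1 (lam a2 a3), lam (lam a1 a2) a3) \<in> poisson_order 3"
    by (rule poisson_order_Lam[OF comb_tree_monomials(3) comb_tree_monomials(1), where i = 1]) (auto simp: small_order_simps)
  show "(lam (lam a1 a3) a2, lam (lam a1 a2) a3) \<in> poisson_order 3"
    by (rule poisson_order_Lam[OF comb_tree_monomials(2) comb_tree_monomials(1), where i = 2]) (auto simp: small_order_simps)
  show "(mu (lam a1 a2) a3, lam a1 (mu a2 a3)) \<in> poisson_order 3"
    by (rule poisson_order_Lam[OF comb_tree_monomials(1) comb_tree_monomials(3), where i = 3]) (auto simp: small_order_simps)
  show "(mu (lam a1 a3) a2, lam a1 (mu a2 a3)) \<in> poisson_order 3"
    by (rule poisson_order_Lam[OF comb_tree_monomials(2) comb_tree_monomials(3), where i = 2]) (auto simp: small_order_simps)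
  show "(mu (lam a1 a2) a3, lam (mu a1 a3) a2) \<in> poisson_order 3"
    by (rule poisson_order_Lam[OF comb_tree_monomials(1) comb_tree_monomials(2), where i = 3]) (auto simp: small_order_simps)
  show "(mu a1 (lam a2 a3), lam (mu a1 a3) a2) \<in> poisson_order 3"
    by (rule poisson_order_Lam[OF comb_tree_monomials(3) comb_tree_monomials(2), where i = 1]) (auto simp: small_order_simps)
  show "(mu a1 (lam a2 a3), lam (mu a1 a2) a3) \<in> poisson_order 3"
    by (rule poisson_order_Lam[OF comb_tree_monomials(3) comb_tree_monomials(1), where i = 1]) (auto simp: small_order_simps)
  show "(mu (lam a1 a3) a2, lam (mu a1 a2) a3) \<in> poisson_order 3"
    by (rule poisson_order_Lam[OF comb_tree_monomials(2) comb_tree_monomials(1), where i = 2]) (auto simp: small_order_simps)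
qed

lemma leading_monomials_Leibniz:
  "is_leading_monomial poisson_order 3
    (monomial (lam a1 (mu a2 a3))
      - (monomial (mu (lam a1 a2) a3) + monomial (mu (lam a1 a3) a2)) :: 'k::field lincomb)
    (lam a1 (mu a2 a3))"
  "is_leading_monomial poisson_order 3
    (- monomial (lam (mu a1 a3) a2)
      - (- monomial (mu (lam a1 a2) a3) + monomial (mu a1 (lam a2 a3))) :: 'k lincomb)
    (lam (mu a1 a3) a2)"
  "is_leading_monomial poisson_order 3
    (- monomial (lam (mu a1 a2) a3)
      - (- monomial (mu a1 (lam a2 a3)) - monomial (mu (lam a1 a3) a2)) :: 'k lincomb)
    (lam (mu a1 a2) a3)"
  by (rule leading_monomial_of_trinomial[OF _ comb_tree_monomials(3) _ comb_order(5,6)]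
      leading_monomial_of_trinomial[OF _ comb_tree_monomials(2) _ comb_order(7,8)]
      leading_monomial_of_trinomial[OF _ comb_tree_monomials(1) _ comb_order(9,10)];
      auto simp: lookup_simps)+

text \<open>Two of the three associative monomials and one Lie monomial become leading, so \<open>leading_trees\<close>
  consists of these three and the three Leibniz monomials.\<close>
lemma leading_monomials_Com_Lie:
  "is_leading_monomial poisson_order 3
    (monomial (mu (mu a1 a2) a3) - monomial (mu a1 (mu a2 a3)) :: 'k::field lincomb)
    (mu (mu a1 a2) a3)"
  "is_leading_monomial poisson_order 3
    (monomial (mu (mu a1 a3) a2) - monomial (mu a1 (mu a2 a3)) :: 'k lincomb)
    (mu (mu a1 a3) a2)"
  "is_leading_monomial poisson_order 3
    (monomial (lam a1 (lam a2 a3))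
      - (monomial (lam (lam a1 a2) a3) - monomial (lam (lam a1 a3) a2)) :: 'k lincomb)
    (lam (lam a1 a2) a3)"
  by (rule leading_monomial_of_trinomial[OF _ comb_tree_monomials(1) _ comb_order(1,1)]
      leading_monomial_of_trinomial[OF _ comb_tree_monomials(2) _ comb_order(2,2)]
      leading_monomial_of_trinomial[OF _ comb_tree_monomials(1) _ comb_order(3,4)];
      auto simp: lookup_simps)+

lemma permute_rewrite_eq_linear_sum:
  "permute_rewrite \<sigma> = linear_sum (\<lambda>t c.
    Poly_Mapping.single (shuffle_form (relabel \<sigma> t)) (shuffle_sign (relabel \<sigma> t) * c))"
  by (simp add: fun_eq_iff permute_rewrite_def linear_sum_def)

lemma permute_rewrite_simps:
  "permute_rewrite \<sigma> (Poly_Mapping.single t c) =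
    Poly_Mapping.single (shuffle_form (relabel \<sigma> t)) (shuffle_sign (relabel \<sigma> t) * c)"
  "permute_rewrite \<sigma> (x + y) = permute_rewrite \<sigma> x + permute_rewrite \<sigma> y"
  "permute_rewrite \<sigma> (x - y) = permute_rewrite \<sigma> x - permute_rewrite \<sigma> y"
  unfolding permute_rewrite_eq_linear_sum
  by (simp_all add: linear_sum_single linear_sum_add linear_sum_diff distrib_left single_add)

lemma poisson_relations_permute:
  assumes "\<sigma> permutes {1..3}" "x \<in> poisson_identities" "y = permute_rewrite \<sigma> x"
  shows "y \<in> poisson_relations 3"
  using assms by (auto simp: poisson_relations_def)

text \<open>Each comes from one of the three identities by the identity permutation or a transposition.\<close>
lemma relations_with_leading_trees:
  "(monomial (mu (mu a1 a2) a3) - monomial (mu a1 (mu a2 a3)) :: 'k::field lincomb) \<in> poisson_relations 3"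
  "(monomial (mu (mu a1 a3) a2) - monomial (mu a1 (mu a2 a3)) :: 'k lincomb) \<in> poisson_relations 3"
  "(monomial (lam a1 (lam a2 a3))
      - (monomial (lam (lam a1 a2) a3) - monomial (lam (lam a1 a3) a2)) :: 'k lincomb) \<in> poisson_relations 3"
  "(monomial (lam a1 (mu a2 a3))
      - (monomial (mu (lam a1 a2) a3) + monomial (mu (lam a1 a3) a2)) :: 'k lincomb) \<in> poisson_relations 3"
  "(- monomial (lam (mu a1 a3) a2)
      - (- monomial (mu (lam a1 a2) a3) + monomial (mu a1 (lam a2 a3))) :: 'k lincomb) \<in> poisson_relations 3"
  "(- monomial (lam (mu a1 a2) a3)
      - (- monomial (mu a1 (lam a2 a3)) - monomial (mu (lam a1 a3) a2)) :: 'k lincomb) \<in> poisson_relations 3"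
proof -
  let ?assoc = "monomial (mu (mu a1 a2) a3) - monomial (mu a1 (mu a2 a3)) :: 'k lincomb"
  let ?Leibniz = "monomial (lam a1 (mu a2 a3))
      - (monomial (mu (lam a1 a2) a3) + monomial (mu (lam a1 a3) a2)) :: 'k lincomb"
  let ?Jacobi = "monomial (lam a1 (lam a2 a3))
      - (monomial (lam (lam a1 a2) a3) - monomial (lam (lam a1 a3) a2)) :: 'k lincomb"
  have identities: "?assoc \<in> poisson_identities" "?Leibniz \<in> poisson_identities" "?Jacobi \<in> poisson_identities"
    by (simp_all add: poisson_identities_def)
  have swaps: "transpose 2 3 permutes {1..3::nat}" "transpose 1 2 permutes {1..3::nat}"
    "transpose 1 3 permutes {1..3::nat}"
    by (auto intro: permutes_swap_id)
  note compute = permute_rewrite_simps transpose_def single_uminus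
  show "?assoc \<in> poisson_relations 3"
    by (rule poisson_relations_permute[OF permutes_id identities(1)]) (simp add: compute)
  show "(monomial (mu (mu a1 a3) a2) - monomial (mu a1 (mu a2 a3)) :: 'k lincomb) \<in> poisson_relations 3"
    by (rule poisson_relations_permute[OF swaps(1) identities(1)]) (simp add: compute)
  show "?Jacobi \<in> poisson_relations 3"
    by (rule poisson_relations_permute[OF permutes_id identities(3)]) (simp add: compute)
  show "?Leibniz \<in> poisson_relations 3"
    by (rule poisson_relations_permute[OF permutes_id identities(2)]) (simp add: compute)
  show "(- monomial (lam (mu a1 a3) a2)
      - (- monomial (mu (lam a1 a2) a3) + monomial (mu a1 (lam a2 a3))) :: 'k lincomb) \<in> poisson_relations 3"
    by (rule poisson_relations_permute[OF swaps(2) identities(2)]) (simp add: compute)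
  show "(- monomial (lam (mu a1 a2) a3)
      - (- monomial (mu a1 (lam a2 a3)) - monomial (mu (lam a1 a3) a2)) :: 'k lincomb) \<in> poisson_relations 3"
    by (rule poisson_relations_permute[OF swaps(3) identities(2)]) (simp add: compute)
qed

lemma leading_trees_are_leading:
  assumes "p \<in> leading_trees"
  shows "\<exists>g \<in> (poisson_relations 3 :: 'k::field lincomb set). is_leading_monomial poisson_order 3 g p"
  using assms unfolding leading_trees_def
  using leading_monomials_Leibniz[where 'k = 'k] leading_monomials_Com_Lie[where 'k = 'k]
    relations_with_leading_trees[where 'k = 'k]
  by (elim insertE emptyE) blast+

lemma exists_greatest_tree:
  assumes "finite A" "A \<noteq> {}" "A \<subseteq> tree_monomials n"
  shows "\<exists>t\<in>A. \<forall>s\<in>A. (s, t) \<in> poisson_order n"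
  using assms
proof (induction A rule: finite_ne_induct)
  case (singleton t)
  then show ?case by (simp add: poisson_order_def)
next
  case (insert u A)
  then obtain t where t: "t \<in> A" "\<forall>s\<in>A. (s, t) \<in> poisson_order n" by auto
  have lin: "trans (poisson_order n)" "total_on (tree_monomials n) (poisson_order n)"
    using linear_order_poisson_order[of n]
    by (simp_all add: linear_order_on_def partial_order_on_def preorder_on_def)
  have u: "(u, u) \<in> poisson_order n" using insert.prems by (simp add: poisson_order_def)
  have "u \<noteq> t" using t insert.hyps by blast
  then consider "(u, t) \<in> poisson_order n" | "(t, u) \<in> poisson_order n"
    using lin(2) t(1) insert.prems by (auto simp: total_on_def)
  then show ?case
  proof cases
    case 1
    then show ?thesis using t by blast
  next
    case 2
    then have "(s, u) \<in> poisson_order n" if "s \<in> A" for s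
      using t(2) that transD[OF lin(1)] by blast
    then show ?thesis using u by blast
  qed
qed

text \<open>By triangularity the functional of a normal leading monomial \<open>t\<close> kills all other terms, so its
  value is the coefficient of \<open>t\<close>, which cannot vanish.\<close>
lemma ideal_leading_monomial_reducible:
  assumes "generated_ideal poisson_relations n (x :: 'k::field lincomb)"
    and "is_leading_monomial poisson_order n x t"
  shows "reducible t"
proof (rule ccontr)
  assume irreducible: "\<not> reducible t"
  have keys: "Poly_Mapping.keys x \<subseteq> tree_monomials n" and zero: "pairing_sum (edges t) x = 0"
    using generated_ideal_vanishing[OF assms(1)] by (auto simp: operad_component_def)
  have t: "t \<in> Poly_Mapping.keys x" "t \<in> tree_monomials n"
    using assms(2) keys by (auto simp: is_leading_monomial_def)
  then have shuffle: "shuffle_tree t" by (simp add: tree_monomials_def)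
  have "pairing (edges t) s = (0 :: 'k)" if "s \<in> Poly_Mapping.keys x" "s \<noteq> t" for s
  proof (rule pairing_edges_triangular)
    show "first_diff_less (key s) (key t)"
      using assms(2) that by (auto simp: is_leading_monomial_def poisson_order_def)
  qed (use t that keys irreducible_normal[OF shuffle irreducible] in auto)
  then have "pairing_sum (edges t) x = Poly_Mapping.lookup x t * pairing (edges t) t"
    unfolding pairing_sum_eq using t(1)
    by (subst sum.remove[of _ t]) (auto intro: sum.neutral)
  then show False
    using zero t(1) pairing_edges_self[OF shuffle, where 'k = 'k] by (simp add: in_keys_iff)
qed

lemma groebner_basis_poisson_relations:
  "groebner_basis poisson_order poisson_relations
    (operad_ideal (poisson_relations :: nat \<Rightarrow> 'k::field lincomb set))"
  unfolding groebner_basis_def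
proof (intro conjI allI impI ballI)
  fix n
  show "poisson_relations n \<subseteq> operad_ideal (poisson_relations :: nat \<Rightarrow> 'k lincomb set) n"
    by (auto simp: operad_ideal_def intro: generated_ideal.generator)
next
  fix n :: nat and x :: "'k lincomb"
  assume "x \<in> operad_ideal poisson_relations n" "x \<noteq> 0"
  then have ideal: "generated_ideal poisson_relations n x" by (simp add: operad_ideal_def)
  then have keys: "Poly_Mapping.keys x \<subseteq> tree_monomials n"
    using generated_ideal_vanishing by (auto simp: operad_component_def)
  moreover have "Poly_Mapping.keys x \<noteq> {}"
    using \<open>x \<noteq> 0\<close> by (metis in_keys_iff empty_iff poly_mapping_eqI lookup_zero)
  ultimately obtain t where "t \<in> Poly_Mapping.keys x" "\<forall>s\<in>Poly_Mapping.keys x. (s, t) \<in> poisson_order n"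
    using exists_greatest_tree[of "Poly_Mapping.keys x" n] by auto
  then have lead: "is_leading_monomial poisson_order n x t" and t: "t \<in> tree_monomials n"
    using keys by (auto simp: is_leading_monomial_def)
  obtain p where p: "p \<in> leading_trees" "tree_divides p t"
    using reducible_divisible[OF ideal_leading_monomial_reducible[OF ideal lead] t] by blast
  then obtain g where "g \<in> (poisson_relations 3 :: 'k lincomb set)" "is_leading_monomial poisson_order 3 g p"
    using leading_trees_are_leading by blast
  then show "\<exists>t k g s. is_leading_monomial poisson_order n x t \<and> 1 \<le> k \<and>
      g \<in> (poisson_relations k :: 'k lincomb set) \<and> is_leading_monomial poisson_order k g s \<and> tree_divides s t"
    using lead p(2) by (intro exI[of _ t] exI[of _ "3 :: nat"] exI[of _ g] exI[of _ p]) simp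
qed

lemma quadratic_poisson_relations: "quadratic (poisson_relations :: nat \<Rightarrow> 'k::field lincomb set)"
  using poisson_relations_keys unfolding quadratic_def by blast

theorem theorem2p1:
  shows "\<exists>ord :: nat \<Rightarrow> nat optree rel.
    monomial_ordering ord \<and>
    is_leading_monomial ord 3
      (monomial (lam a1 (mu a2 a3))
        - (monomial (mu (lam a1 a2) a3) + monomial (mu (lam a1 a3) a2)) :: 'k::field lincomb)
      (lam a1 (mu a2 a3)) \<and>
    is_leading_monomial ord 3
      (- monomial (lam (mu a1 a3) a2)
        - (- monomial (mu (lam a1 a2) a3) + monomial (mu a1 (lam a2 a3))) :: 'k lincomb)
      (lam (mu a1 a3) a2) \<and>
    is_leading_monomial ord 3
      (- monomial (lam (mu a1 a2) a3)
        - (- monomial (mu a1 (lam a2 a3)) - monomial (mu (lam a1 a3) a2)) :: 'k lincomb)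
      (lam (mu a1 a2) a3) \<and>
    quadratic (poisson_relations :: nat \<Rightarrow> 'k lincomb set) \<and>
    groebner_basis ord (poisson_relations :: nat \<Rightarrow> 'k lincomb set) (operad_ideal poisson_relations)"
  using monomial_ordering_poisson_order leading_monomials_Leibniz[where 'k = 'k]
    quadratic_poisson_relations[where 'k = 'k] groebner_basis_poisson_relations[where 'k = 'k]
  by blast

end
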